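(* Let $p\in[0,1)$. Each function $f\in\Sigma(p)$, with expansion $f(z)=\frac1{z-p}+\sum_{n=0}^\infty b_nz^n$ in $\mathbb{D}$, satisfies the inequality $$\left|f'(z)+\frac1{(z-p)^2}\right|\le\frac{1}{(1-p^2)(1-|z|^2)},\qquad z\in\mathbb{D}.$$ Moreover, equality holds at a point $z=z_0\in\mathbb{D}\setminus\{0,p\}$ if and only if, for a constant $b_0$, $$f(z)=\frac1{z-p}+b_0-\left(\frac{z_0^{-1}-\bar z_0}{1-p^2}\right)\left(\frac{\bar z_0-p}{z_0-p}\right)\left(\frac{z_0z}{1-\bar z_0z}\right),\qquad z\in\mathbb{D}.$$
   Context: $\mathbb{D}=\{|z|<1\}$. $\Sigma(p)$ is the class of univalent meromorphic functions $f$ on $\mathbb{D}$ with a simple pole at $z=p$ of residue $1$. At $z=p$ the expression $f'(z)+\frac1{(z-p)^2}$ is understood by its removable-singularity value, i.e. it is the derivative of the analytic function $\sum_{n\ge0}b_nz^n$ on $\mathbb{D}$. *)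

theory Defs
  imports "HOL-Complex_Analysis.Complex_Analysis"
begin

(* The value of f in the Riemann sphere, with None playing the role of \<infinity>.
   A total HOL function carries an arbitrary complex number at a pole; that number is ignored. *)
definition sphere_value :: "(complex \<Rightarrow> complex) \<Rightarrow> complex \<Rightarrow> complex option" where
  "sphere_value f z = (if is_pole f z then None else Some (f z))"

(* The continuity clause rules out the wrong values at removable singularities
   that meromorphic_on permits. *)
definition univalent_meromorphic_on :: "(complex \<Rightarrow> complex) \<Rightarrow> complex set \<Rightarrow> bool" where
  "univalent_meromorphic_on f A \<longleftrightarrow>
     f meromorphic_on A \<and> (\<forall>z\<in>A. is_pole f z \<or> isCont f z) \<and> inj_on (sphere_value f) A"

definition Sigma_class :: "real \<Rightarrow> (complex \<Rightarrow> complex) set" where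
  "Sigma_class p = {f. univalent_meromorphic_on f (ball 0 1) \<and>
     is_pole f (of_real p) \<and> zorder f (of_real p) = -1 \<and> residue f (of_real p) = 1}"

(* f'(z) + 1/(z - p)^2, read at z = p as the value that removes the singularity *)
definition regular_deriv :: "real \<Rightarrow> (complex \<Rightarrow> complex) \<Rightarrow> complex \<Rightarrow> complex" where
  "regular_deriv p f = remove_sings (\<lambda>w. deriv f w + 1 / (w - of_real p)\<^sup>2)"

end

theory Submission
  imports Defs
begin

no_notation fps_nth (infixl "$" 75)

text \<open>
The bound expresses that the complement of a univalent image has nonnegative area. Let first
\<open>p = 0\<close>, so that \<open>h(z) = 1/z + \<Sum> b\<^sub>n z\<^sup>n\<close> is injective on the punctured disc. The region
left out by \<open>h\<close> has area \<open>\<pi> (1 - \<Sum> n |b\<^sub>n|\<^sup>2)\<close>, and hence \<open>\<Sum> n |b\<^sub>n|\<^sup>2 \<le> 1\<close>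
(\<open>area_theorem\<close>, due to Gronwall). The derivative of the regular part is
\<open>\<Sum> n b\<^sub>n z\<^bsup>n-1\<^esup>\<close>, and the Cauchy-Schwarz inequality with weights \<open>n\<close> bounds its modulus by
the square root of \<open>\<Sum> n |z|\<^bsup>2(n-1)\<^esup> = 1/(1-|z|\<^sup>2)\<^sup>2\<close>. Equality forces
\<open>b\<^sub>n = \<mu> cnj(z)\<^bsup>n-1\<^esup>\<close> with \<open>|\<mu>| = 1-|z|\<^sup>2\<close> (\<open>weighted_cauchy_schwarz_defect\<close>), and
for \<open>z \<noteq> 0\<close> only one argument of \<open>\<mu>\<close> is compatible with injectivity
(\<open>extremal_phase_of_injective\<close>).

The area theorem is proved without line integrals. The image of the annulus
\<open>\<epsilon> < |z| < r\<close> is parametrised by \<open>s + it \<mapsto> h(exp(s + it))\<close> on a rectangle. The change of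
variables formula and a Bessel inequality on each circle bound its area from below by
\<open>\<pi> (1/\<epsilon>\<^sup>2 - 1/r\<^sup>2 + \<Sum> n |b\<^sub>n|\<^sup>2 (r\<^bsup>2n\<^esup> - \<epsilon>\<^bsup>2n\<^esup>))\<close>. On the other hand
the image lies inside an ellipse that encloses the image of the inner circle with an error that
vanishes with \<open>\<epsilon>\<close> even after area is taken (\<open>image_outside_circle_in_ellipse\<close>); its area is at
most \<open>\<pi> (1/\<epsilon> + C \<epsilon>\<^sup>2)\<^sup>2\<close>. Comparing the two and letting \<open>\<epsilon> \<rightarrow> 0\<close>, then \<open>r \<rightarrow> 1\<close>,
gives the claim.

For general \<open>p\<close>, composing \<open>f\<close> with the automorphism \<open>w \<mapsto> (w+p)/(1+pw)\<close> of the disc and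
multiplying by \<open>1-p\<^sup>2\<close> moves the pole to \<open>0\<close> with residue 1. The derivative bound transforms by
the factor \<open>1/(1-p\<^sup>2)\<close> because the automorphism is an isometry of the hyperbolic metric
(\<open>derivative_bound\<close>).
\<close>

section \<open>Areas of holomorphic images\<close>

text \<open>
Area and Jacobian determinants are taken on the Cartesian plane, derivatives on the complex line;
the next two mutually inverse isometries pass between them.
\<close>

definition plane_to_complex :: "real^2 \<Rightarrow> complex" where
  "plane_to_complex x = Complex (x$1) (x$2)"

definition complex_to_plane :: "complex \<Rightarrow> real^2" where
  "complex_to_plane z = vector [Re z, Im z]"

lemma plane_complex_inverse [simp]:
  "plane_to_complex (complex_to_plane z) = z" "complex_to_plane (plane_to_complex x) = x"
  by (simp_all add: plane_to_complex_def complex_to_plane_def vec_eq_iff forall_2)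

lemma bounded_linear_plane_to_complex: "bounded_linear plane_to_complex"
  unfolding plane_to_complex_def
  by (intro linear_conv_bounded_linear[THEN iffD1] linearI) (auto simp: complex_eq_iff)

lemma bounded_linear_complex_to_plane: "bounded_linear complex_to_plane"
  unfolding complex_to_plane_def
  by (intro linear_conv_bounded_linear[THEN iffD1] linearI) (auto simp: vec_eq_iff forall_2)

lemma norm_plane_to_complex: "norm (plane_to_complex x) = norm x"
  by (simp add: plane_to_complex_def norm_vec_def L2_set_def UNIV_2 cmod_def)

text \<open>
Both determinants of the area estimate are instances of this one: a complex derivative has
\<open>k = 0\<close>, and the real-linear map carrying a disc to an ellipse has \<open>m = 1\<close>.
\<close>

lemma det_complex_linear:
  "det (matrix (\<lambda>v. complex_to_plane (m * plane_to_complex v + k * cnj (plane_to_complex v))))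
     = (norm m)\<^sup>2 - (norm k)\<^sup>2"
  unfolding cmod_power2
  by (simp add: det_2 matrix_def plane_to_complex_def complex_to_plane_def axis_def
      power2_eq_square algebra_simps)

lemma integral_plane_rectangle:
  fixes k :: "real \<Rightarrow> real \<Rightarrow> real"
  assumes "continuous_on (cbox (a, c) (b, d)) (\<lambda>(s, t). k s t)"
  shows "((\<lambda>x::real^2. k (x$1) (x$2)) has_integral
           integral {a..b} (\<lambda>s. integral {c..d} (k s))) (cbox (vector [a, c]) (vector [b, d]))"
proof -
  define g where "g = (\<lambda>x::real^2. (x$1, x$2))"
  define h where "h = (\<lambda>y::real\<times>real. vector [fst y, snd y] :: real^2)"
  have gi: "g ` cbox u v = cbox (g u) (g v)" for u v
  proof -
    have "y \<in> g ` cbox u v" if "y \<in> cbox (g u) (g v)" for y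
      by (rule image_eqI[of _ _ "h y"])
        (use that in \<open>auto simp: g_def h_def cbox_Pair_eq mem_box_cart forall_2\<close>)
    then show ?thesis
      by (auto simp: g_def cbox_Pair_eq mem_box_cart forall_2)
  qed
  have hg: "h (g x) = x" for x by (simp add: g_def h_def vec_eq_iff forall_2)
  have gh: "g (h x) = x" for x by (simp add: g_def h_def)
  have hi: "h ` cbox u v = cbox (h u) (h v)" for u v
    using gi[of "h u" "h v"] by (metis (no_types, lifting) gh hg image_image image_cong image_ident)
  have "((\<lambda>y. k (fst y) (snd y)) has_integral integral (cbox (a,c) (b,d)) (\<lambda>y. k (fst y) (snd y)))
          (cbox (a,c) (b,d))"
    using assms by (intro integrable_integral integrable_continuous) (simp add: case_prod_beta)
  then have "((\<lambda>x. k (fst (g x)) (snd (g x))) has_integral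
      (1/1) *\<^sub>R integral (cbox (a,c) (b,d)) (\<lambda>y. k (fst y) (snd y))) (h ` cbox (a,c) (b,d))"
  proof (rule has_integral_twiddle[rotated -1])
    show "continuous (at x) g" for x unfolding g_def by (intro continuous_intros)
    show "measure lborel (g ` cbox u v) = 1 * measure lborel (cbox u v)" for u v
    proof -
      have "measure lborel (cbox u v) = (if cbox u v = {} then 0 else (v$1-u$1)*(v$2-u$2))"
        by (simp add: content_cbox_if_cart UNIV_2)
      moreover have "measure lborel (cbox (g u) (g v)) = measure lborel {u$1..v$1} * measure lborel {u$2..v$2}"
        by (simp add: g_def content_Pair)
      moreover have "(\<exists>i::2. P i) \<longleftrightarrow> P 1 \<or> P 2" for P by (metis exhaust_2)
      ultimately show ?thesis unfolding gi
        by (auto simp: interval_eq_empty_cart content_real_if)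
    qed
    show "\<exists>w z. g ` cbox u v = cbox w z" for u v using gi by blast
    show "\<exists>w z. h ` cbox u v = cbox w z" for u v using hi by blast
  qed (simp_all add: gh hg)
  moreover have "integral (cbox (a,c) (b,d)) (\<lambda>y. k (fst y) (snd y)) =
      integral {a..b} (\<lambda>s. integral {c..d} (k s))"
    using integral_prod_continuous[of a c b d "\<lambda>y. k (fst y) (snd y)"] assms
    by (simp add: case_prod_beta)
  ultimately show ?thesis unfolding hi by (simp add: g_def h_def)
qed

text \<open>
For injective holomorphic \<open>F\<close> the integral is the area of the image, since the real Jacobian is
\<open>|F'|\<^sup>2\<close>. The image lies in an ellipse obtained from a disc of radius \<open>R\<close> by a map of
determinant \<open>1 - |\<alpha>|\<^sup>2 \<in> [0, 1]\<close>. Differentiability and continuity are asked on the closed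
rectangle but injectivity only on the open one, because the logarithmic parametrisation of an
annulus identifies two opposite sides.
\<close>

lemma area_le_of_image_in_ellipse:
  fixes F F' :: "complex \<Rightarrow> complex"
  assumes der: "\<And>s t. s \<in> {a..b} \<Longrightarrow> t \<in> {c..d} \<Longrightarrow>
                  (F has_field_derivative F' (Complex s t)) (at (Complex s t))"
    and cont: "continuous_on (cbox (a, c) (b, d)) (\<lambda>(s, t). F' (Complex s t))"
    and inj: "inj_on F {Complex s t |s t. a < s \<and> s < b \<and> c < t \<and> t < d}"
    and img: "\<And>s t. a < s \<Longrightarrow> s < b \<Longrightarrow> c < t \<Longrightarrow> t < d \<Longrightarrow>
                \<exists>u. norm u \<le> R \<and> F (Complex s t) = w + (u + \<alpha> * cnj u)"
    and "norm \<alpha> \<le> 1" "R \<ge> 0"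
  shows "integral {a..b} (\<lambda>s. integral {c..d} (\<lambda>t. (norm (F' (Complex s t)))\<^sup>2)) \<le> pi * R\<^sup>2"
proof -
  let ?u = "vector [a, c] :: real^2" and ?v = "vector [b, d] :: real^2"
  define S where "S = box ?u ?v"
  define \<phi> where "\<phi> = (\<lambda>x. complex_to_plane (F (plane_to_complex x)))"
  define \<phi>' where "\<phi>' = (\<lambda>x v. complex_to_plane (F' (plane_to_complex x) * plane_to_complex v))"
  define L where "L = (\<lambda>v. complex_to_plane (plane_to_complex v + \<alpha> * cnj (plane_to_complex v)))"
  have Sco: "a < x$1 \<and> x$1 < b \<and> c < x$2 \<and> x$2 < d" if "x \<in> S" for x
    using that by (auto simp: S_def mem_box_cart forall_2)
  have det: "\<bar>det (matrix (\<phi>' x))\<bar> = (norm (F' (plane_to_complex x)))\<^sup>2" for x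
    using det_complex_linear[of "F' (plane_to_complex x)" 0] by (simp add: \<phi>'_def)
  have contk: "continuous_on (cbox (a, c) (b, d)) (\<lambda>(s, t). (norm (F' (Complex s t)))\<^sup>2)"
    using cont unfolding case_prod_beta
    by (auto intro!: continuous_intros intro: continuous_on_subset)
  have int: "((\<lambda>x. \<bar>det (matrix (\<phi>' x))\<bar>) has_integral
      integral {a..b} (\<lambda>s. integral {c..d} (\<lambda>t. (norm (F' (Complex s t)))\<^sup>2))) S"
    using integral_plane_rectangle[OF contk]
    unfolding S_def has_integral_open_interval det plane_to_complex_def .
  have der\<phi>: "(\<phi> has_derivative \<phi>' x) (at x within S)" if "x \<in> S" for x
  proof -
    have "(F has_derivative (*) (F' (plane_to_complex x))) (at (plane_to_complex x))"
      using der[of "x$1" "x$2"] Sco[OF that]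
      by (simp add: plane_to_complex_def has_field_derivative_def)
    then have "((\<lambda>x. F (plane_to_complex x)) has_derivative
        (\<lambda>v. F' (plane_to_complex x) * plane_to_complex v)) (at x within S)"
      by (rule has_derivative_compose[rotated])
        (rule bounded_linear_imp_has_derivative[OF bounded_linear_plane_to_complex])
    from bounded_linear.has_derivative[OF bounded_linear_complex_to_plane this]
    show ?thesis by (simp add: \<phi>_def \<phi>'_def)
  qed
  have inj\<phi>: "inj_on \<phi> S"
  proof (rule inj_onI)
    fix x y assume xy: "x \<in> S" "y \<in> S" "\<phi> x = \<phi> y"
    then have "F (plane_to_complex x) = F (plane_to_complex y)"
      unfolding \<phi>_def by (metis plane_complex_inverse(1))
    moreover have "plane_to_complex z \<in> {Complex s t |s t. a < s \<and> s < b \<and> c < t \<and> t < d}"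
      if "z \<in> S" for z using Sco[OF that] by (auto simp: plane_to_complex_def)
    ultimately have "plane_to_complex x = plane_to_complex y"
      using inj xy(1,2) by (meson inj_onD)
    then show "x = y" by (metis plane_complex_inverse(2))
  qed
  have Smeas: "S \<in> sets lebesgue" by (simp add: S_def)
  have intS: "(\<lambda>x. \<bar>det (matrix (\<phi>' x))\<bar>) integrable_on S" using int by blast
  have linL: "linear L"
    unfolding L_def
    by (intro linearI) (auto simp: plane_to_complex_def complex_to_plane_def vec_eq_iff forall_2 algebra_simps)
  let ?E = "(+) (complex_to_plane w) ` (L ` cball 0 R)"
  have Lmeas: "L ` cball 0 R \<in> lmeasurable"
    by (rule measurable_linear_image[OF linL]) (rule lmeasurable_cball)
  have sub: "\<phi> ` S \<subseteq> ?E"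
  proof
    fix y assume "y \<in> \<phi> ` S"
    then obtain x where x: "x \<in> S" "y = \<phi> x" by blast
    from img[of "x$1" "x$2"] Sco[OF x(1)] obtain u where
      u: "norm u \<le> R" "F (plane_to_complex x) = w + (u + \<alpha> * cnj u)"
      by (auto simp: plane_to_complex_def)
    have "y = complex_to_plane w + L (complex_to_plane u)"
      unfolding x \<phi>_def u L_def
      by (simp add: linear_add[OF bounded_linear.linear[OF bounded_linear_complex_to_plane]])
    moreover have "complex_to_plane u \<in> cball 0 R"
      using u(1) norm_plane_to_complex[of "complex_to_plane u"] by simp
    ultimately show "y \<in> ?E" by blast
  qed
  have "integral S (\<lambda>x. \<bar>det (matrix (\<phi>' x))\<bar>) = measure lebesgue (\<phi> ` S)"
    using measure_differentiable_image_eq[OF Smeas der\<phi> inj\<phi> intS] by simp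
  also have "\<dots> \<le> measure lebesgue ?E"
    using measurable_differentiable_image_eq[OF Smeas der\<phi> inj\<phi>] intS
    by (intro measure_mono_fmeasurable sub measurable_translation Lmeas) auto
  also have "\<dots> = \<bar>det (matrix L)\<bar> * measure lebesgue (cball (0::real^2) R)"
    using measure_linear_image[OF linL lmeasurable_cball] by (simp add: measure_translation)
  also have "\<dots> = \<bar>1 - (norm \<alpha>)\<^sup>2\<bar> * (pi * R\<^sup>2)"
    using det_complex_linear[of 1 \<alpha>] \<open>R \<ge> 0\<close>
    by (simp add: L_def content_cball unit_ball_vol_2)
  also have "\<dots> \<le> 1 * (pi * R\<^sup>2)"
    using power_le_one[OF norm_ge_zero \<open>norm \<alpha> \<le> 1\<close>, of 2] by (intro mult_right_mono) auto
  finally show ?thesis using int by (simp add: integral_unique)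
qed

section \<open>Mean squares on circles\<close>

lemma mean_value_circle:
  assumes "m holomorphic_on ball 0 1" "0 < \<rho>" "\<rho> < 1"
  shows "((\<lambda>t. m (of_real \<rho> * cis t)) has_integral 2 * of_real pi * m 0) {0..2*pi}"
proof -
  have "m holomorphic_on cball 0 \<rho>"
    using assms by (auto intro: holomorphic_on_subset)
  then have "((\<lambda>u. m u / (u - 0)) has_contour_integral 2 * of_real pi * \<i> * m 0)
      (part_circlepath 0 \<rho> 0 (2*pi))"
    using Cauchy_integral_circlepath_simple[of m 0 \<rho> 0] assms(2) by (simp add: circlepath_def)
  then have "((\<lambda>t. m (of_real \<rho> * cis t) * \<i>) has_integral 2 * of_real pi * \<i> * m 0) {0..2*pi}"
    using \<open>0 < \<rho>\<close> by (simp add: has_contour_integral_part_circlepath_iff)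
  from has_integral_mult_left[OF this, of "-\<i>"] show ?thesis by (simp add: mult_ac)
qed

lemma holomorphic_powser_disc:
  fixes a :: "nat \<Rightarrow> complex"
  assumes "\<And>z. z \<in> ball 0 1 \<Longrightarrow> summable (\<lambda>n. a n * z ^ n)"
  shows "(\<lambda>z. \<Sum>n. a n * z ^ n) holomorphic_on ball 0 1"
  by (rule power_series_holomorphic[where a=a])
    (use assms summable_sums in \<open>auto simp: dist_norm\<close>)

text \<open>
Peeling off one coefficient at a time avoids all interchange of sums and integrals: in
\<open>a(z) = a\<^sub>0 + z q(z)\<close> the two summands are orthogonal on the circle, because
\<open>z q(z)\<close> has mean value 0 there.
\<close>

lemma bessel_circle:
  fixes a :: "nat \<Rightarrow> complex"
  assumes "\<And>z. z \<in> ball 0 1 \<Longrightarrow> summable (\<lambda>n. a n * z ^ n)" and \<rho>: "0 < \<rho>" "\<rho> < 1"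
  shows "2 * pi * (\<Sum>n<N. (norm (a n))\<^sup>2 * \<rho> ^ (2 * n))
           \<le> integral {0..2*pi} (\<lambda>t. (norm (\<Sum>n. a n * (of_real \<rho> * cis t) ^ n))\<^sup>2)"
  using assms(1)
proof (induction N arbitrary: a)
  case 0
  have "0 \<le> integral {0..2*pi} (\<lambda>t. (norm (\<Sum>n. a n * (of_real \<rho> * cis t) ^ n))\<^sup>2)"
    by (cases "(\<lambda>t. (norm (\<Sum>n. a n * (of_real \<rho> * cis t) ^ n))\<^sup>2) integrable_on {0..2*pi}")
      (auto intro: Henstock_Kurzweil_Integration.integral_nonneg simp: not_integrable_integral)
  then show ?case by simp
next
  case (Suc N)
  define k where "k = (\<lambda>a (z::complex). \<Sum>n. a n * z ^ n :: complex)"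
  define q where "q = k (\<lambda>n. a (Suc n))"
  have sm: "summable (\<lambda>n. a (Suc n) * z ^ n)" if "z \<in> ball 0 1" for z
    using Suc.prems[OF that] by (subst (asm) summable_powser_split_head[symmetric]) 
  have hol: "q holomorphic_on ball 0 1"
    unfolding q_def k_def by (intro holomorphic_powser_disc sm)
  have split: "k a z = a 0 + z * q z" if "z \<in> ball 0 1" for z
    unfolding k_def q_def using powser_split_head(1)[OF Suc.prems[OF that]] by (simp add: mult.commute)
  let ?z = "\<lambda>t. of_real \<rho> * cis t :: complex"
  have zin: "?z t \<in> ball 0 1" for t using \<rho> by (simp add: norm_mult)
  have contq: "continuous_on {0..2*pi} (\<lambda>t. q (?z t))"
    by (rule continuous_on_compose2[OF holomorphic_on_imp_continuous_on[OF hol]])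
      (use zin in \<open>auto intro!: continuous_intros\<close>)
  have holz: "(\<lambda>z. z * q z) holomorphic_on ball 0 1" by (intro holomorphic_intros hol)
  have "((\<lambda>t. cnj (a 0) * (?z t * q (?z t))) has_integral cnj (a 0) * 0) {0..2*pi}"
    by (rule has_integral_mult_right) (use mean_value_circle[OF holz \<rho>] in simp)
  from has_integral_mult_right[OF has_integral_Re[OF this], of 2]
  have cross: "((\<lambda>t. 2 * Re (cnj (a 0) * (?z t * q (?z t)))) has_integral 0) {0..2*pi}" by simp
  have "(\<lambda>t. (norm (q (?z t)))\<^sup>2) integrable_on {0..2*pi}"
    by (intro integrable_continuous_real continuous_intros contq)
  then have q2: "((\<lambda>t. \<rho>\<^sup>2 * (norm (q (?z t)))\<^sup>2) has_integral
      \<rho>\<^sup>2 * integral {0..2*pi} (\<lambda>t. (norm (q (?z t)))\<^sup>2)) {0..2*pi}"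
    by (intro has_integral_mult_right integrable_integral)
  have c: "((\<lambda>t::real. (norm (a 0))\<^sup>2) has_integral 2 * pi * (norm (a 0))\<^sup>2) {0..2*pi}"
    using has_integral_const_real[of "(norm (a 0))\<^sup>2" 0 "2*pi"] by simp
  have sq: "(norm (k a (?z t)))\<^sup>2 =
      (norm (a 0))\<^sup>2 + 2 * Re (cnj (a 0) * (?z t * q (?z t))) + \<rho>\<^sup>2 * (norm (q (?z t)))\<^sup>2" for t
  proof -
    have "(norm (x + y))\<^sup>2 = (norm x)\<^sup>2 + 2 * Re (cnj x * y) + (norm y)\<^sup>2" for x y :: complex
      unfolding cmod_power2 by (simp add: power2_eq_square algebra_simps)
    then show ?thesis using \<rho> by (simp add: split[OF zin] norm_mult power_mult_distrib)
  qed
  have "((\<lambda>t. (norm (k a (?z t)))\<^sup>2) has_integral 2 * pi * (norm (a 0))\<^sup>2 + 0 +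
      \<rho>\<^sup>2 * integral {0..2*pi} (\<lambda>t. (norm (q (?z t)))\<^sup>2)) {0..2*pi}"
    unfolding sq by (intro has_integral_add c cross q2)
  then have "integral {0..2*pi} (\<lambda>t. (norm (k a (?z t)))\<^sup>2) = 2 * pi * (norm (a 0))\<^sup>2 +
      \<rho>\<^sup>2 * integral {0..2*pi} (\<lambda>t. (norm (q (?z t)))\<^sup>2)"
    by (simp add: integral_unique)
  moreover have "\<rho>\<^sup>2 * (2 * pi * (\<Sum>n<N. (norm (a (Suc n)))\<^sup>2 * \<rho> ^ (2 * n)))
      \<le> \<rho>\<^sup>2 * integral {0..2*pi} (\<lambda>t. (norm (q (?z t)))\<^sup>2)"
    using Suc.IH[of "\<lambda>n. a (Suc n)", OF sm] unfolding q_def k_def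
    by (intro mult_left_mono) auto
  moreover have "2 * pi * (\<Sum>n<Suc N. (norm (a n))\<^sup>2 * \<rho> ^ (2 * n)) = 2 * pi * (norm (a 0))\<^sup>2 +
      \<rho>\<^sup>2 * (2 * pi * (\<Sum>n<N. (norm (a (Suc n)))\<^sup>2 * \<rho> ^ (2 * n)))"
    unfolding sum.lessThan_Suc_shift
    by (simp add: sum_distrib_left algebra_simps power2_eq_square)
  ultimately show ?case unfolding k_def by simp
qed

section \<open>Images near a simple pole\<close>

text \<open>
Topologically: near the pole \<open>h\<close> covers a neighbourhood of \<open>\<infinity>\<close>, and the values taken inside
the circle can only stop at values taken on it. The complement of \<open>E\<close> is connected and avoids
the latter, so all of it is covered from inside the circle. By injectivity nothing outside the
circle can be mapped there.
\<close>

lemma image_outside_circle_in_convex: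
  fixes h :: "complex \<Rightarrow> complex"
  assumes hol: "h holomorphic_on ball 0 1 - {0}" and inj: "inj_on h (ball 0 1 - {0})"
    and pole: "is_pole h 0" and \<epsilon>: "0 < \<epsilon>" "\<epsilon> < 1"
    and E: "convex E" "bounded E" "h ` sphere 0 \<epsilon> \<subseteq> E"
    and z: "\<epsilon> < norm z" "norm z < 1"
  shows "h z \<in> E"
proof -
  define U where "U = h ` (ball 0 \<epsilon> - {0})"
  define K where "K = h ` (cball 0 \<epsilon> - {0})"
  have openU: "open U"
    unfolding U_def
    by (rule open_mapping_thm3)
      (use \<epsilon> in \<open>auto intro: holomorphic_on_subset[OF hol] inj_on_subset[OF inj]\<close>)
  have lim: "filterlim h at_infinity (at 0)" using pole by (simp add: is_pole_def)
  \<comment> \<open>properness: a sequence of values that converges cannot come from points tending to the pole\<close>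
  have closedK: "closed K"
    unfolding closed_sequential_limits
  proof (intro allI impI, elim conjE)
    fix x l assume x: "\<forall>n. x n \<in> K" and xl: "x \<longlonglongrightarrow> l"
    from x have "\<forall>n. \<exists>y. y \<in> cball 0 \<epsilon> - {0} \<and> x n = h y" unfolding K_def by blast
    then obtain y where y: "\<And>n. y n \<in> cball 0 \<epsilon>" "\<And>n. y n \<noteq> 0" "\<And>n. x n = h (y n)"
      by (metis Diff_iff insertCI)
    have "seq_compact (cball (0::complex) \<epsilon>)"
      by (simp add: compact_imp_seq_compact)
    then obtain v r where v: "v \<in> cball 0 \<epsilon>" "strict_mono r" "(y \<circ> r) \<longlonglongrightarrow> v"
      using y(1) by (metis seq_compactE)
    have xr: "(\<lambda>n. h ((y \<circ> r) n)) \<longlonglongrightarrow> l"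
      using LIMSEQ_subseq_LIMSEQ[OF xl v(2)] y(3) by (simp add: o_def)
    show "l \<in> K"
    proof (cases "v = 0")
      case True
      have "filterlim (y \<circ> r) (at 0) sequentially"
        using v(3) y(2) True by (simp add: filterlim_at)
      then have "filterlim (\<lambda>n. h ((y \<circ> r) n)) at_infinity sequentially"
        by (rule filterlim_compose[OF lim])
      then have False
        using xr not_tendsto_and_filterlim_at_infinity[of sequentially] by auto
      then show ?thesis ..
    next
      case False
      have "v \<in> ball 0 1 - {0}" using v(1) \<epsilon> False by auto
      then have "isCont h v"
        using holomorphic_on_imp_continuous_on[OF hol]
        by (simp add: continuous_on_eq_continuous_at open_delete)
      then have "(\<lambda>n. h ((y \<circ> r) n)) \<longlonglongrightarrow> h v"
        using v(3) by (rule isCont_tendsto_compose)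
      then have "l = h v" using xr LIMSEQ_unique by blast
      then show ?thesis using v(1) False by (auto simp: K_def)
    qed
  qed
  have "connected (- E)"
    by (rule connected_complement_bounded_convex) (use E in auto)
  moreover have "- E \<subseteq> U \<union> - K"
  proof -
    have "cball 0 \<epsilon> - {0} \<subseteq> (ball 0 \<epsilon> - {0}) \<union> sphere (0::complex) \<epsilon>" by auto
    then have "K \<subseteq> U \<union> E" using E(3) unfolding K_def U_def by blast
    then show ?thesis by blast
  qed
  moreover have "U \<inter> - K \<inter> - E = {}" by (force simp: U_def K_def)
  moreover have "U \<inter> - E \<noteq> {}"
  proof -
    obtain B where B: "\<And>w. w \<in> E \<Longrightarrow> norm w \<le> B" using E(2) bounded_iff by blast
    have "eventually (\<lambda>w. B < norm (h w)) (at 0)"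
      using lim by (metis filterlim_at_infinity_imp_norm_at_top filterlim_at_top_dense)
    moreover have "eventually (\<lambda>w. w \<in> ball 0 \<epsilon> - {0}) (at 0)"
      using eventually_at_in_open[of "ball 0 \<epsilon>" 0 ] \<epsilon> by simp
    ultimately have "eventually (\<lambda>w. B < norm (h w) \<and> w \<in> ball 0 \<epsilon> - {0}) (at 0)"
      by (rule eventually_conj)
    then obtain w where "B < norm (h w)" "w \<in> ball 0 \<epsilon> - {0}"
      using eventually_happens'[of "at (0::complex)"] by auto
    then have "h w \<in> U" "h w \<notin> E" using B by (force simp: U_def)+
    then show ?thesis by blast
  qed
  ultimately have "- K \<inter> - E = {}"
    using openU closedK connectedD[of "- E" U "- K"] by blast
  moreover have "h z \<in> - K"
  proof -
    have "h z \<noteq> h y" if "y \<in> cball 0 \<epsilon> - {0}" for y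
      using inj that z \<epsilon> by (intro notI) (force dest!: inj_onD[of h _ z y])
    then show ?thesis unfolding K_def by blast
  qed
  ultimately show ?thesis by blast
qed

text \<open>
The real-linear map \<open>v \<mapsto> v + \<alpha> cnj v\<close> has inverse
\<open>y \<mapsto> (y - \<alpha> cnj y)/(1 - |\<alpha>|\<^sup>2)\<close>, whose norm is at most \<open>1/(1 - |\<alpha>|)\<close>.
\<close>

lemma ellipse_map_surj:
  fixes \<alpha> y :: complex
  assumes "norm \<alpha> \<le> 1/2"
  obtains v where "v + \<alpha> * cnj v = y" "norm v \<le> 2 * norm y"
proof -
  define d where "d = 1 - (norm \<alpha>)\<^sup>2"
  define v where "v = (y - \<alpha> * cnj y) / of_real d"
  have d: "d = (1 - norm \<alpha>) * (1 + norm \<alpha>)" by (simp add: d_def power2_eq_square algebra_simps)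
  have dpos: "d > 0" unfolding d by (rule mult_pos_pos) (use assms norm_ge_zero[of \<alpha>] in linarith)+
  have aa: "\<alpha> * cnj \<alpha> = 1 - of_real d"
    unfolding d_def using complex_norm_square[of \<alpha>] by simp
  have "v + \<alpha> * cnj v = (y - \<alpha> * cnj \<alpha> * y) / of_real d"
    by (simp add: v_def add_divide_distrib diff_divide_distrib algebra_simps)
  also have "\<dots> = y" using dpos unfolding aa by (simp add: algebra_simps)
  finally have 1: "v + \<alpha> * cnj v = y" .
  have "norm (y - \<alpha> * cnj y) \<le> norm y + norm \<alpha> * norm y"
    by (metis complex_mod_cnj norm_mult norm_triangle_ineq4)
  moreover have "norm v * d = norm (y - \<alpha> * cnj y)"
    using dpos by (simp add: v_def norm_divide)
  ultimately have "norm v * d \<le> (1 + norm \<alpha>) * norm y" by (simp add: algebra_simps)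
  then have "norm v * (1 - norm \<alpha>) * (1 + norm \<alpha>) \<le> norm y * (1 + norm \<alpha>)"
    unfolding d by (simp add: mult_ac)
  then have "norm v * (1 - norm \<alpha>) \<le> norm y"
    by (rule mult_right_le_imp_le) (use norm_ge_zero[of \<alpha>] in linarith)
  moreover have "norm v * (1/2) \<le> norm v * (1 - norm \<alpha>)"
    by (rule mult_left_mono) (use assms in auto)
  ultimately have "norm v \<le> 2 * norm y" by linarith
  with 1 show ?thesis by (rule that)
qed

text \<open>
On \<open>|z| = \<epsilon>\<close> one has \<open>z = \<epsilon>\<^sup>2 cnj(1/z)\<close>, so \<open>1/z + b\<^sub>1 z = u + \<epsilon>\<^sup>2 b\<^sub>1 cnj u\<close> with
\<open>u = 1/z\<close>: the circle is mapped to an ellipse up to an error of order \<open>\<epsilon>\<^sup>2\<close>. A disc in place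
of the ellipse would have to be larger by a multiple of \<open>\<epsilon>\<close>, and that costs a positive constant
in area, which is too much.
\<close>

lemma image_outside_circle_in_ellipse:
  fixes b :: "nat \<Rightarrow> complex"
  defines "h \<equiv> \<lambda>z. 1 / z + (\<Sum>n. b n * z ^ n)"
  assumes sm: "\<And>z. z \<in> ball 0 1 \<Longrightarrow> summable (\<lambda>n. b n * z ^ n)"
    and inj: "inj_on h (ball 0 1 - {0})"
  shows "\<exists>\<delta> C. 0 < \<delta> \<and> \<delta> < 1 \<and> 0 \<le> C \<and> (\<forall>\<epsilon>. 0 < \<epsilon> \<and> \<epsilon> < \<delta> \<longrightarrow>
           norm (of_real (\<epsilon>\<^sup>2) * b 1) \<le> 1 \<and>
           (\<forall>z. \<epsilon> < norm z \<and> norm z < 1 \<longrightarrow>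
             (\<exists>u. norm u \<le> 1 / \<epsilon> + C * \<epsilon>\<^sup>2 \<and>
                  h z = b 0 + (u + of_real (\<epsilon>\<^sup>2) * b 1 * cnj u))))"
proof -
  define k where "k = (\<lambda>z. \<Sum>n. b n * z ^ n)"
  define r where "r = (\<lambda>z. \<Sum>n. b (Suc (Suc n)) * z ^ n)"
  have sm1: "summable (\<lambda>n. b (Suc n) * z ^ n)" if "z \<in> ball 0 1" for z
    using sm[OF that] by (subst (asm) summable_powser_split_head[symmetric])
  have sm2: "summable (\<lambda>n. b (Suc (Suc n)) * z ^ n)" if "z \<in> ball 0 1" for z
    using sm1[OF that] by (subst (asm) summable_powser_split_head[symmetric])
  have kr: "k z = b 0 + b 1 * z + z\<^sup>2 * r z" if "z \<in> ball 0 1" for z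
    unfolding k_def r_def using powser_split_head(1)[OF sm[OF that]] powser_split_head(1)[OF sm1[OF that]]
    by (simp add: algebra_simps power2_eq_square)
  have holk: "k holomorphic_on ball 0 1" unfolding k_def by (rule holomorphic_powser_disc[OF sm])
  have holr: "r holomorphic_on ball 0 1" unfolding r_def by (rule holomorphic_powser_disc[OF sm2])
  have hk: "h = (\<lambda>z. 1 / z + k z)" by (simp add: h_def k_def)
  have "compact (r ` cball 0 (1/2))"
    by (intro compact_continuous_image holomorphic_on_imp_continuous_on holomorphic_on_subset[OF holr]) auto
  then have "bounded (r ` cball 0 (1/2))" by (rule compact_imp_bounded)
  then obtain B where "\<forall>w\<in>r ` cball 0 (1/2). norm w \<le> B" unfolding bounded_iff by blast
  then have B: "norm (r z) \<le> B" if "norm z \<le> 1/2" for z using that by auto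
  have "0 \<le> B" using B[of 0] norm_ge_zero[of "r 0"] by (simp del: norm_ge_zero)
  \<comment> \<open>small enough for both \<open>\<epsilon> \<le> 1/2\<close>, where \<open>r\<close> is bounded, and \<open>|\<epsilon>\<^sup>2 b\<^sub>1| \<le> 1/2\<close>\<close>
  define \<delta> where "\<delta> = 1 / (2 * (1 + norm (b 1)))"
  have \<delta>: "0 < \<delta>" "\<delta> \<le> 1/2" "\<delta> * norm (b 1) \<le> 1/2"
    using norm_ge_zero[of "b 1"] by (auto simp: \<delta>_def field_simps add_pos_nonneg)
  have a: "norm (of_real (\<epsilon>\<^sup>2) * b 1) \<le> 1/2" if "0 < \<epsilon>" "\<epsilon> < \<delta>" for \<epsilon>
  proof -
    have "\<epsilon>\<^sup>2 \<le> \<epsilon>" using that \<delta> by (simp add: power2_eq_square mult_left_le)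
    then have "\<epsilon>\<^sup>2 * norm (b 1) \<le> \<delta> * norm (b 1)" using that by (intro mult_right_mono) auto
    then show ?thesis using \<delta>(3) by (simp add: norm_mult norm_power)
  qed
  have main: "\<exists>u. norm u \<le> 1 / \<epsilon> + 2 * B * \<epsilon>\<^sup>2 \<and> h z = b 0 + (u + of_real (\<epsilon>\<^sup>2) * b 1 * cnj u)"
    if \<epsilon>: "0 < \<epsilon>" "\<epsilon> < \<delta>" and z: "\<epsilon> < norm z" "norm z < 1" for \<epsilon> z
  proof -
    let ?R = "1 / \<epsilon> + 2 * B * \<epsilon>\<^sup>2" and ?\<alpha> = "of_real (\<epsilon>\<^sup>2) * b 1"
    let ?L = "\<lambda>u. u + ?\<alpha> * cnj u"
    define E where "E = (+) (b 0) ` ?L ` cball 0 ?R"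
    have lin: "linear ?L" by (intro linearI) (auto simp: algebra_simps scaleR_conv_of_real)
    have "bounded (?L ` cball 0 ?R)"
      by (rule bounded_linear_image) (use lin linear_conv_bounded_linear in auto)
    then have bE: "bounded E" unfolding E_def by (rule bounded_translation)
    have cE: "convex E"
      unfolding E_def by (intro convex_translation convex_linear_image[OF lin] convex_cball)
    have circ: "h ` sphere 0 \<epsilon> \<subseteq> E"
    proof
      fix y assume "y \<in> h ` sphere 0 \<epsilon>"
      then obtain x where x: "norm x = \<epsilon>" "y = h x" by auto
      obtain v where v: "v + ?\<alpha> * cnj v = x\<^sup>2 * r x" "norm v \<le> 2 * norm (x\<^sup>2 * r x)"
        using ellipse_map_surj[OF a[OF \<epsilon>]] by metis
      have "x \<noteq> 0" using x \<epsilon> by auto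
      have xx: "of_real (\<epsilon>\<^sup>2) = x * cnj x" using x(1) complex_norm_square[of x] by simp
      have "?\<alpha> * cnj (1/x) = b 1 * x" unfolding xx using \<open>x \<noteq> 0\<close> by simp
      then have "?L (1/x + v) = 1/x + b 1 * x + x\<^sup>2 * r x"
        unfolding v(1)[symmetric] by (simp add: distrib_left)
      moreover have "h x = b 0 + (1/x + b 1 * x + x\<^sup>2 * r x)"
        using kr[of x] x(1) \<epsilon> \<delta> by (simp add: hk)
      moreover have "norm (1/x + v) \<le> ?R"
      proof -
        have "norm (x\<^sup>2 * r x) \<le> \<epsilon>\<^sup>2 * B"
          unfolding norm_mult norm_power x(1) by (intro mult_left_mono B) (use x \<epsilon> \<delta> in auto)
        then have "norm v \<le> 2 * B * \<epsilon>\<^sup>2" using v(2) by (simp add: mult_ac)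
        moreover have "norm (1/x + v) \<le> norm (1/x) + norm v" by (rule norm_triangle_ineq)
        ultimately show ?thesis using x(1) by (simp add: norm_divide)
      qed
      ultimately show "y \<in> E" unfolding E_def x(2) by (intro image_eqI[OF _ image_eqI[OF _ ]]) auto
    qed
    have holh: "h holomorphic_on ball 0 1 - {0}"
      unfolding hk by (intro holomorphic_intros holomorphic_on_subset[OF holk]) auto
    have "isCont k 0" using holomorphic_on_imp_continuous_on[OF holk]
      by (simp add: continuous_on_eq_continuous_at)
    then have "(k \<longlongrightarrow> k 0) (at 0)" by (simp add: isCont_def)
    moreover have "(\<lambda>z::complex. 1 / z) = inverse" by (simp add: fun_eq_iff inverse_eq_divide)
    then have "filterlim (\<lambda>z::complex. 1 / z) at_infinity (at 0)"
      using filterlim_inverse_at_infinity by simp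
    ultimately have "is_pole h 0"
      unfolding is_pole_def hk using tendsto_add_filterlim_at_infinity' by blast
    from image_outside_circle_in_convex[OF holh inj this \<epsilon>(1) _ cE bE circ z]
    have "h z \<in> E" using \<epsilon> \<delta> by simp
    then show ?thesis unfolding E_def by auto
  qed
  have "norm (of_real (\<epsilon>\<^sup>2) * b 1) \<le> 1" if "0 < \<epsilon>" "\<epsilon> < \<delta>" for \<epsilon>
    using a[OF that] by linarith
  moreover have "\<delta> < 1" "0 \<le> 2 * B" using \<delta> \<open>0 \<le> B\<close> by auto
  ultimately show ?thesis using main \<delta>(1) by blast
qed

section \<open>The area theorem\<close>

lemma powser_disc_deriv:
  fixes b :: "nat \<Rightarrow> complex"
  assumes "\<And>z. z \<in> ball 0 1 \<Longrightarrow> summable (\<lambda>n. b n * z ^ n)" and z: "z \<in> ball 0 1"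
  shows "((\<lambda>w. \<Sum>n. b n * w ^ n) has_field_derivative (\<Sum>n. diffs b n * z ^ n)) (at z)"
    and "summable (\<lambda>n. diffs b n * z ^ n)"
proof -
  obtain K where K: "norm z < K" "K < 1" using z dense[of "norm z" 1] by auto
  have sK: "summable (\<lambda>n. b n * w ^ n)" if "norm w < 1" for w using assms(1)[of w] that by simp
  have "norm z < norm (of_real K :: complex)" "summable (\<lambda>n. b n * of_real K ^ n)"
    using K sK[of "of_real K"] norm_ge_zero[of z] by (auto simp del: norm_ge_zero)
  then show "((\<lambda>w. \<Sum>n. b n * w ^ n) has_field_derivative (\<Sum>n. diffs b n * z ^ n)) (at z)"
    by (intro termdiffs_strong)
  show "summable (\<lambda>n. diffs b n * z ^ n)"
    by (rule termdiff_converges[of z 1]) (use z sK in auto)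
qed

text \<open>
The two estimates of the area of the image of an annulus, divided by \<open>\<pi>\<close>. The lower one comes
from \<open>z\<^sup>2 h'(z) = -1 + \<Sum> n b\<^sub>n z\<^bsup>n+1\<^esup>\<close>, a power series without pole to which the Bessel
inequality applies circle by circle.
\<close>

lemma log_polar_area_le:
  fixes b :: "nat \<Rightarrow> complex"
  defines "h \<equiv> \<lambda>z. 1 / z + (\<Sum>n. b n * z ^ n)"
  assumes sm: "\<And>z. z \<in> ball 0 1 \<Longrightarrow> summable (\<lambda>n. b n * z ^ n)"
    and inj: "inj_on h (ball 0 1 - {0})"
    and \<epsilon>: "0 < \<epsilon>" "\<epsilon> < r" "r < 1" and \<alpha>: "norm \<alpha> \<le> 1" and R: "R \<ge> 0"
    and img: "\<And>z. \<epsilon> < norm z \<Longrightarrow> norm z < 1 \<Longrightarrow> \<exists>u. norm u \<le> R \<and> h z = w + (u + \<alpha> * cnj u)"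
  shows "(1 / \<epsilon>\<^sup>2 - 1 / r\<^sup>2) + (\<Sum>n=1..N. n * (norm (b n))\<^sup>2 * (r ^ (2 * n) - \<epsilon> ^ (2 * n))) \<le> R\<^sup>2"
proof -
  \<comment> \<open>the coefficients of \<open>z\<^sup>2 h'(z)\<close>; at \<open>n = 0\<close> the truncated \<open>n - 1\<close> makes the second summand vanish\<close>
  define a where "a = (\<lambda>n. (if n = 0 then - 1 else 0) + of_nat (n - 1) * b (n - 1) :: complex)"
  define K where "K = (\<lambda>z. \<Sum>n. a n * z ^ n)"
  define F where "F = (\<lambda>u. h (exp u))"
  define F' where "F' = (\<lambda>u. K (exp u) / exp u)"
  have a2: "a (Suc (Suc n)) = diffs b n" for n by (simp add: a_def diffs_def)
  have sa: "summable (\<lambda>n. a n * z ^ n)" if "z \<in> ball 0 1" for z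
  proof -
    have "summable (\<lambda>n. a (Suc (Suc n)) * z ^ n)"
      unfolding a2 using powser_disc_deriv(2)[OF sm that] .
    then have "summable (\<lambda>n. a (Suc n) * z ^ n)" by (subst (asm) summable_powser_split_head)
    then show ?thesis by (subst (asm) summable_powser_split_head)
  qed
  have K: "K z = - 1 + z\<^sup>2 * (\<Sum>n. diffs b n * z ^ n)" if z: "z \<in> ball 0 1" for z
  proof -
    have "summable (\<lambda>n. a (Suc n) * z ^ n)"
      using sa[OF z] by (subst summable_powser_split_head)
    then show ?thesis
      unfolding K_def using powser_split_head(1)[OF sa[OF z]] powser_split_head(1)[of "\<lambda>n. a (Suc n)" z]
      by (simp add: a2 power2_eq_square algebra_simps) (simp add: a_def)
  qed
  have holK: "K holomorphic_on ball 0 1" unfolding K_def by (rule holomorphic_powser_disc[OF sa])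
  have derh: "(h has_field_derivative K z / z\<^sup>2) (at z)" if "z \<in> ball 0 1 - {0}" for z
  proof -
    have "(h has_field_derivative (- 1 / z\<^sup>2 + (\<Sum>n. diffs b n * z ^ n))) (at z)"
      unfolding h_def using that
      by (auto intro!: derivative_eq_intros powser_disc_deriv(1)[OF sm] simp: power2_eq_square)
    moreover have "K z / z\<^sup>2 = - 1 / z\<^sup>2 + (\<Sum>n. diffs b n * z ^ n)"
      using that K[of z] by (simp add: add_divide_distrib diff_divide_distrib)
    ultimately show ?thesis by simp
  qed
  have expC: "exp (Complex s t) = of_real (exp s) * cis t" for s t
    by (simp add: exp_eq_polar)
  have lnr: "exp s < 1" if "s \<le> ln r" for s
  proof -
    have "exp s \<le> exp (ln r)" using that by simp
    then have "exp s \<le> r" using \<epsilon> by simp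
    then show ?thesis using \<epsilon>(3) by linarith
  qed
  have expin: "exp (Complex s t) \<in> ball 0 1 - {0}" if "s \<le> ln r" for s t
    using lnr[OF that] by simp
  have contF': "continuous_on (cbox (ln \<epsilon>, 0) (ln r, 2*pi)) (\<lambda>(s, t). F' (Complex s t))"
  proof -
    have C: "continuous_on A (\<lambda>x. exp (Complex (fst x) (snd x)))" for A
      unfolding expC by (intro continuous_intros)
    have "continuous_on (cbox (ln \<epsilon>, 0) (ln r, 2*pi)) (\<lambda>x. K (exp (Complex (fst x) (snd x))))"
      by (rule continuous_on_compose2[OF holomorphic_on_imp_continuous_on[OF holK] C])
        (use lnr in \<open>auto simp: cbox_Pair_eq\<close>)
    then show ?thesis unfolding F'_def case_prod_beta by (intro continuous_intros C) auto
  qed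
  have area: "integral {ln \<epsilon>..ln r} (\<lambda>s. integral {0..2*pi} (\<lambda>t. (norm (F' (Complex s t)))\<^sup>2)) \<le> pi * R\<^sup>2"
  proof (rule area_le_of_image_in_ellipse[OF _ contF' _ _ \<alpha> R])
    fix s t assume "s \<in> {ln \<epsilon>..ln r}" "t \<in> {0..2*pi}"
    then have "(h has_field_derivative K (exp (Complex s t)) / (exp (Complex s t))\<^sup>2) (at (exp (Complex s t)))"
      by (intro derh expin) auto
    from DERIV_chain2[OF this DERIV_exp]
    show "(F has_field_derivative F' (Complex s t)) (at (Complex s t))"
      by (simp add: F_def F'_def power2_eq_square)
  next
    show "inj_on F {Complex s t |s t. ln \<epsilon> < s \<and> s < ln r \<and> 0 < t \<and> t < 2 * pi}"
    proof (rule inj_onI, clarify)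
      fix s t s' t' :: real
      assume *: "s < ln r" "s' < ln r" "0 < t" "t < 2*pi" "0 < t'" "t' < 2*pi"
        "F (Complex s t) = F (Complex s' t')"
      have "exp (Complex s t) = exp (Complex s' t')"
      proof (rule inj_onD[OF inj])
        show "h (exp (Complex s t)) = h (exp (Complex s' t'))" using *(7) by (simp only: F_def)
        show "exp (Complex s t) \<in> ball 0 1 - {0}" using *(1) by (intro expin less_imp_le)
        show "exp (Complex s' t') \<in> ball 0 1 - {0}" using *(2) by (intro expin less_imp_le)
      qed
      moreover have "\<bar>Im (Complex s t) - Im (Complex s' t')\<bar> < 2 * pi" using *(3-6) by simp
      ultimately have "Complex s t = Complex s' t'" by (metis exp_complex_eqI)
      then show "s = s' \<and> t = t'" by simp
    qed
  next
    fix s t assume *: "ln \<epsilon> < s" "s < ln r"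
    have "exp (ln \<epsilon>) < exp s" using * by simp
    then have "\<epsilon> < norm (exp (Complex s t))" using \<epsilon> by simp
    moreover have "norm (exp (Complex s t)) < 1" using lnr[of s] * by simp
    ultimately show "\<exists>u. norm u \<le> R \<and> F (Complex s t) = w + (u + \<alpha> * cnj u)"
      unfolding F_def by (rule img)
  qed
  \<comment> \<open>\<open>P s\<close> is the Bessel lower bound on the circle of radius \<open>exp s\<close>, and \<open>A\<close> is its antiderivative\<close>
  define P where "P = (\<lambda>s. 2 * pi * (exp (-2 * s) + (\<Sum>n=1..N. (n * norm (b n))\<^sup>2 * exp (2 * real n * s))))"
  define A where "A = (\<lambda>s. pi * (- exp (-2 * s) + (\<Sum>n=1..N. n * (norm (b n))\<^sup>2 * exp (2 * real n * s))))"
  have "(P has_integral (A (ln r) - A (ln \<epsilon>))) {ln \<epsilon>..ln r}"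
  proof (rule fundamental_theorem_of_calculus)
    show "ln \<epsilon> \<le> ln r" using \<epsilon> by simp
    fix s assume "s \<in> {ln \<epsilon>..ln r}"
    have "(A has_real_derivative P s) (at s within {ln \<epsilon>..ln r})"
      unfolding A_def P_def
      by (auto intro!: derivative_eq_intros sum.cong simp: sum_distrib_left power2_eq_square algebra_simps)
    then show "(A has_vector_derivative P s) (at s within {ln \<epsilon>..ln r})"
      by (simp add: has_real_derivative_iff_has_vector_derivative)
  qed
  then have "A (ln r) - A (ln \<epsilon>) \<le> integral {ln \<epsilon>..ln r} (\<lambda>s. integral {0..2*pi} (\<lambda>t. (norm (F' (Complex s t)))\<^sup>2))"
  proof (rule has_integral_le)
    have "continuous_on (cbox (ln \<epsilon>) (ln r)) (\<lambda>s. integral (cbox 0 (2*pi)) (\<lambda>t. (norm (F' (Complex s t)))\<^sup>2))"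
      by (rule integral_continuous_on_param)
        (use contF' in \<open>auto simp: case_prod_beta cbox_Pair_eq intro!: continuous_intros\<close>)
    then show "((\<lambda>s. integral {0..2*pi} (\<lambda>t. (norm (F' (Complex s t)))\<^sup>2)) has_integral
       integral {ln \<epsilon>..ln r} (\<lambda>s. integral {0..2*pi} (\<lambda>t. (norm (F' (Complex s t)))\<^sup>2))) {ln \<epsilon>..ln r}"
      by (intro integrable_integral integrable_continuous_real) simp
  next
    fix s assume s: "s \<in> {ln \<epsilon>..ln r}"
    let ?\<rho> = "exp s"
    \<comment> \<open>two more terms than \<open>N\<close>: the constant -1 and the vanishing linear coefficient\<close>
    have "2 * pi * (\<Sum>n<N+2. (norm (a n))\<^sup>2 * ?\<rho> ^ (2 * n))
        \<le> integral {0..2*pi} (\<lambda>t. (norm (K (of_real ?\<rho> * cis t)))\<^sup>2)"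
      unfolding K_def using bessel_circle[OF sa, of ?\<rho> "N+2"] lnr[of s] s by simp
    also have "\<dots> = integral {0..2*pi} (\<lambda>t. ?\<rho>\<^sup>2 * (norm (F' (Complex s t)))\<^sup>2)"
      by (rule integral_cong) (simp add: F'_def expC norm_divide norm_mult power_divide)
    also have "\<dots> = ?\<rho>\<^sup>2 * integral {0..2*pi} (\<lambda>t. (norm (F' (Complex s t)))\<^sup>2)" by simp
    finally have 1: "2 * pi * (\<Sum>n<N+2. (norm (a n))\<^sup>2 * ?\<rho> ^ (2 * n)) \<le>
      ?\<rho>\<^sup>2 * integral {0..2*pi} (\<lambda>t. (norm (F' (Complex s t)))\<^sup>2)" .
    have "(\<Sum>n<N+2. (norm (a n))\<^sup>2 * ?\<rho> ^ (2 * n)) =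
        1 + (\<Sum>n<N. (norm (of_nat (Suc n) * b (Suc n)))\<^sup>2 * ?\<rho> ^ (2 * Suc (Suc n)))"
      unfolding add_2_eq_Suc' sum.lessThan_Suc_shift a2 by (simp add: a_def diffs_def)
    also have "(\<Sum>n<N. (norm (of_nat (Suc n) * b (Suc n)))\<^sup>2 * ?\<rho> ^ (2 * Suc (Suc n))) =
        (\<Sum>n=1..N. (n * norm (b n))\<^sup>2 * ?\<rho> ^ (2 * Suc n))"
      by (rule sum.reindex_bij_witness[of _ "\<lambda>n. n - 1" Suc]) (auto simp: norm_mult simp del: of_nat_Suc)
    also have "\<dots> = ?\<rho>\<^sup>2 * (\<Sum>n=1..N. (n * norm (b n))\<^sup>2 * exp (2 * real n * s))"
      unfolding sum_distrib_left
      by (intro sum.cong) (simp_all add: exp_of_nat_mult[symmetric] mult_exp_exp algebra_simps exp_double[symmetric])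
    also have "1 = ?\<rho>\<^sup>2 * exp (-2 * s)" by (simp add: exp_double[symmetric] mult_exp_exp)
    finally have "?\<rho>\<^sup>2 * P s \<le> ?\<rho>\<^sup>2 * integral {0..2*pi} (\<lambda>t. (norm (F' (Complex s t)))\<^sup>2)"
      using 1 by (simp add: P_def algebra_simps)
    then show "P s \<le> integral {0..2*pi} (\<lambda>t. (norm (F' (Complex s t)))\<^sup>2)" by simp
  qed
  with area have "A (ln r) - A (ln \<epsilon>) \<le> pi * R\<^sup>2" by linarith
  moreover have "A (ln \<rho>) = pi * (- (1 / \<rho>\<^sup>2) + (\<Sum>n=1..N. n * (norm (b n))\<^sup>2 * \<rho> ^ (2 * n)))"
    if "\<rho> > 0" for \<rho>
  proof -
    have 1: "exp (2 * real n * ln \<rho>) = \<rho> ^ (2 * n)" for n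
      using that by (metis exp_ln exp_of_nat_mult of_nat_mult of_nat_numeral)
    have "exp (-2 * ln \<rho>) = 1 / \<rho>\<^sup>2" using 1[of 1] by (simp add: exp_minus divide_inverse)
    then show ?thesis by (simp add: A_def 1)
  qed
  ultimately have "pi * ((1 / \<epsilon>\<^sup>2 - 1 / r\<^sup>2) + (\<Sum>n=1..N. n * (norm (b n))\<^sup>2 * (r ^ (2 * n) - \<epsilon> ^ (2 * n)))) \<le> pi * R\<^sup>2"
    using \<epsilon> by (simp add: algebra_simps sum_subtractf)
  then show ?thesis by simp
qed

text \<open>
Gronwall's area theorem. The terms \<open>1/\<epsilon>\<^sup>2\<close> of the two area estimates cancel, and what remains
of the upper estimate is \<open>2 C \<epsilon> + C\<^sup>2 \<epsilon>\<^sup>4\<close>.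
\<close>

theorem area_theorem:
  fixes b :: "nat \<Rightarrow> complex"
  assumes sm: "\<And>z. z \<in> ball 0 1 \<Longrightarrow> summable (\<lambda>n. b n * z ^ n)"
    and inj: "inj_on (\<lambda>z. 1 / z + (\<Sum>n. b n * z ^ n)) (ball 0 1 - {0})"
  shows "(\<Sum>n=1..N. n * (norm (b n))\<^sup>2) \<le> 1"
proof -
  obtain \<delta> C where \<delta>: "0 < \<delta>" "\<delta> < 1" "0 \<le> C"
    and *: "\<forall>\<epsilon>. 0 < \<epsilon> \<and> \<epsilon> < \<delta> \<longrightarrow> norm (of_real (\<epsilon>\<^sup>2) * b 1) \<le> 1 \<and>
       (\<forall>z. \<epsilon> < norm z \<and> norm z < 1 \<longrightarrow> (\<exists>u. norm u \<le> 1 / \<epsilon> + C * \<epsilon>\<^sup>2 \<and>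
         1 / z + (\<Sum>n. b n * z ^ n) = b 0 + (u + of_real (\<epsilon>\<^sup>2) * b 1 * cnj u)))"
    using image_outside_circle_in_ellipse[OF sm inj] by blast
  have r: "(\<Sum>n=1..N. n * (norm (b n))\<^sup>2 * r ^ (2 * n)) \<le> 1 / r\<^sup>2" if r: "0 < r" "r < 1" for r
  proof -
    let ?B = "\<lambda>\<epsilon>. 1 / r\<^sup>2 + (\<Sum>n=1..N. n * (norm (b n))\<^sup>2 * \<epsilon> ^ (2 * n)) + 2 * C * \<epsilon> + C\<^sup>2 * \<epsilon> ^ 4"
    have le: "(\<Sum>n=1..N. n * (norm (b n))\<^sup>2 * r ^ (2 * n)) \<le> ?B \<epsilon>" if \<epsilon>: "0 < \<epsilon>" "\<epsilon> < min \<delta> r" for \<epsilon>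
    proof -
      have "(1 / \<epsilon>\<^sup>2 - 1 / r\<^sup>2) + (\<Sum>n=1..N. n * (norm (b n))\<^sup>2 * (r ^ (2 * n) - \<epsilon> ^ (2 * n)))
          \<le> (1 / \<epsilon> + C * \<epsilon>\<^sup>2)\<^sup>2"
        by (rule log_polar_area_le[OF sm inj \<epsilon>(1) _ r(2), where \<alpha>="of_real (\<epsilon>\<^sup>2) * b 1" and w="b 0"])
          (use * \<epsilon> \<delta> in auto)
      also have "\<dots> = 1 / \<epsilon>\<^sup>2 + 2 * C * \<epsilon> + C\<^sup>2 * \<epsilon> ^ 4"
        using \<epsilon> by (simp add: power2_sum field_simps power2_eq_square power4_eq_xxxx)
      finally show ?thesis by (simp add: algebra_simps sum_subtractf)
    qed
    have "(?B \<longlongrightarrow> ?B 0) (at_right 0)"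
      by (intro tendsto_intros)
    moreover have "\<forall>\<^sub>F \<epsilon> in at_right 0. (\<Sum>n=1..N. n * (norm (b n))\<^sup>2 * r ^ (2 * n)) \<le> ?B \<epsilon>"
    proof (rule eventually_mono[OF eventually_at_right_real[of 0 "min \<delta> r"]])
      show "0 < min \<delta> r" using \<delta> r by simp
    qed (rule le; simp)
    ultimately have "(\<Sum>n=1..N. n * (norm (b n))\<^sup>2 * r ^ (2 * n)) \<le> ?B 0"
      by (intro tendsto_lowerbound) auto
    also have "?B 0 = 1 / r\<^sup>2" by (simp add: power_0_left)
    finally show ?thesis .
  qed
  have "((\<lambda>r. \<Sum>n=1..N. n * (norm (b n))\<^sup>2 * r ^ (2 * n)) \<longlongrightarrow> (\<Sum>n=1..N. n * (norm (b n))\<^sup>2 * 1 ^ (2 * n))) (at_left 1)"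
    by (intro tendsto_intros)
  moreover have "((\<lambda>r::real. 1 / r\<^sup>2) \<longlongrightarrow> 1 / 1\<^sup>2) (at_left 1)"
    by (intro tendsto_intros) auto
  moreover have "\<forall>\<^sub>F r in at_left (1::real). (\<Sum>n=1..N. n * (norm (b n))\<^sup>2 * r ^ (2 * n)) \<le> 1 / r\<^sup>2"
    by (rule eventually_mono[OF eventually_at_left_real[of 0 "1::real"]]) (simp, intro r, simp_all)
  ultimately have "(\<Sum>n=1..N. n * (norm (b n))\<^sup>2 * 1 ^ (2 * n)) \<le> 1 / (1::real)\<^sup>2"
    by (intro tendsto_le[of "at_left (1::real)"]) auto
  then show ?thesis by simp
qed

section \<open>The derivative bound for a pole at the origin\<close>

text \<open>
The Cauchy-Schwarz inequality together with its equality case. With \<open>q = 1 - |z|\<^sup>2\<close>, expanding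
the square gives \<open>\<Sum> (n+1) |c\<^sub>n - \<mu> cnj(z)\<^sup>n|\<^sup>2 = \<Sum> (n+1) |c\<^sub>n|\<^sup>2 - |d|\<^sup>2 q\<^sup>2 \<le> 1 - |d|\<^sup>2 q\<^sup>2\<close>
for the projection coefficient \<open>\<mu> = d q\<^sup>2\<close>. The left side is nonnegative, and it vanishes when
\<open>|d| = 1/q\<close>.
\<close>

lemma weighted_cauchy_schwarz_defect:
  fixes c :: "nat \<Rightarrow> complex"
  assumes z: "norm z < 1"
    and bound: "\<And>N. (\<Sum>n<N. real (Suc n) * (norm (c n))\<^sup>2) \<le> 1"
    and d: "(\<lambda>n. of_nat (Suc n) * c n * z ^ n) sums d"
  defines "\<mu> \<equiv> d * of_real ((1 - (norm z)\<^sup>2)\<^sup>2)"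
  shows "norm d \<le> 1 / (1 - (norm z)\<^sup>2)"
    and "norm d = 1 / (1 - (norm z)\<^sup>2) \<Longrightarrow> c n = \<mu> * cnj z ^ n"
proof -
  define q where "q = 1 - (norm z)\<^sup>2"
  have q: "q > 0" using z by (simp add: q_def abs_square_less_1)
  have \<mu>: "\<mu> = d * of_real (q\<^sup>2)" by (simp add: \<mu>_def q_def)
  define D where "D = (\<lambda>n. real (Suc n) * (norm (c n - \<mu> * cnj z ^ n))\<^sup>2)"
  define S where "S = (\<Sum>n. real (Suc n) * (norm (c n))\<^sup>2)"
  have smS: "summable (\<lambda>n. real (Suc n) * (norm (c n))\<^sup>2)"
  proof (rule bounded_imp_summable[where B=1])
    show "(\<Sum>k\<le>n. real (Suc k) * (norm (c k))\<^sup>2) \<le> 1" for n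
      using bound[of "Suc n"] by (simp only: lessThan_Suc_atMost)
  qed simp
  have S1: "S \<le> 1" unfolding S_def
    using bound smS suminf_le_const by blast
  have k: "(\<lambda>n. real (Suc n) * ((norm z)\<^sup>2) ^ n) sums (1 / q\<^sup>2)"
    unfolding q_def by (rule geometric_deriv_sums) (use z in \<open>simp add: abs_square_less_1\<close>)
  have Deq: "D n = real (Suc n) * (norm (c n))\<^sup>2 - 2 * Re (cnj \<mu> * (of_nat (Suc n) * c n * z ^ n))
      + (norm \<mu>)\<^sup>2 * (real (Suc n) * ((norm z)\<^sup>2) ^ n)" for n
  proof -
    have "(norm (x - y))\<^sup>2 = (norm x)\<^sup>2 - 2 * Re (cnj y * x) + (norm y)\<^sup>2" for x y :: complex
      unfolding cmod_power2 by (simp add: power2_eq_square algebra_simps)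
    from this[of "c n" "\<mu> * cnj z ^ n"]
    have "(norm (c n - \<mu> * cnj z ^ n))\<^sup>2 =
        (norm (c n))\<^sup>2 - 2 * Re (cnj (\<mu> * cnj z ^ n) * c n) + (norm (\<mu> * cnj z ^ n))\<^sup>2" .
    also have "cnj (\<mu> * cnj z ^ n) = cnj \<mu> * z ^ n" by simp
    also have "(norm (\<mu> * cnj z ^ n))\<^sup>2 = (norm \<mu>)\<^sup>2 * ((norm z)\<^sup>2) ^ n"
      by (simp add: norm_mult norm_power power_mult_distrib power_mult[symmetric] mult.commute)
    finally have "D n = real (Suc n) * ((norm (c n))\<^sup>2 - 2 * Re (cnj \<mu> * z ^ n * c n) + (norm \<mu>)\<^sup>2 * ((norm z)\<^sup>2) ^ n)"
      by (simp only: D_def)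
    moreover have "cnj \<mu> * (of_nat (Suc n) * c n * z ^ n) = of_real (real (Suc n)) * (cnj \<mu> * z ^ n * c n)"
      by (simp add: mult_ac)
    ultimately show ?thesis by (simp add: ring_distribs del: of_nat_Suc)
  qed
  have "D sums (S - 2 * Re (cnj \<mu> * d) + (norm \<mu>)\<^sup>2 * (1 / q\<^sup>2))"
    unfolding Deq[abs_def]
    by (intro sums_add sums_diff sums_mult sums_Re d k) (use smS in \<open>simp add: S_def summable_sums\<close>)
  also have "S - 2 * Re (cnj \<mu> * d) + (norm \<mu>)\<^sup>2 * (1 / q\<^sup>2) = S - (norm d)\<^sup>2 * q\<^sup>2"
  proof -
    have "cnj \<mu> * d = of_real (q\<^sup>2 * (norm d)\<^sup>2)"
      unfolding \<mu> using complex_norm_square[of d] by (simp add: mult_ac)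
    then have "Re (cnj \<mu> * d) = q\<^sup>2 * (norm d)\<^sup>2" by (simp only: Re_complex_of_real)
    moreover have "(norm \<mu>)\<^sup>2 = (norm d)\<^sup>2 * (q\<^sup>2)\<^sup>2"
      by (simp add: \<mu> norm_mult norm_power power_mult_distrib)
    ultimately show ?thesis using q by (simp add: power2_eq_square)
  qed
  finally have Ds: "D sums (S - (norm d * q)\<^sup>2)" by (simp add: power_mult_distrib)
  have Dpos: "0 \<le> D n" for n by (simp add: D_def)
  have "0 \<le> S - (norm d * q)\<^sup>2"
    using Ds Dpos by (metis sums_le sums_0 sums_unique suminf_nonneg sums_summable)
  then have "(norm d * q)\<^sup>2 \<le> 1\<^sup>2" using S1 by simp
  then have "norm d * q \<le> 1" by (rule power2_le_imp_le) simp
  then show "norm d \<le> 1 / (1 - (norm z)\<^sup>2)" using q by (simp add: q_def field_simps)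
  show "c n = \<mu> * cnj z ^ n" if "norm d = 1 / (1 - (norm z)\<^sup>2)"
  proof -
    have "norm d * q = 1" using that q by (simp add: q_def)
    then have "suminf D \<le> 0" using Ds S1 by (simp add: sums_unique[symmetric])
    then have "suminf D = 0" using suminf_nonneg[OF sums_summable[OF Ds] Dpos] by simp
    then have "D n = 0" using suminf_eq_zero_iff[OF sums_summable[OF Ds] Dpos] by simp
    then show ?thesis by (simp add: D_def del: of_nat_Suc)
  qed
qed

text \<open>
In the coordinate \<open>u = 1/w - cnj z\<close> the function is \<open>u + \<mu>/u\<close> up to a constant, so it takes
equal values at \<open>u\<close> and \<open>\<mu>/u\<close>. The unit disc corresponds to the exterior of the unit circle
about \<open>- cnj z\<close>, and \<open>u \<mapsto> \<mu>/u\<close> carries that exterior to the unit disc about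
\<open>c = \<mu> z/(1 - |z|\<^sup>2)\<close>. Injectivity keeps the two regions disjoint, apart from fixed points of
\<open>u \<mapsto> \<mu>/u\<close>, and this is possible only if the centres \<open>c\<close> and \<open>- cnj z\<close> coincide.
\<close>

lemma extremal_phase_of_injective:
  fixes z \<mu> b0 :: complex
  assumes z: "norm z < 1" and \<mu>: "norm \<mu> = 1 - (norm z)\<^sup>2"
    and inj: "inj_on (\<lambda>w. 1 / w + (b0 + \<mu> * (w / (1 - cnj z * w)))) (ball 0 1 - {0})"
  shows "\<mu> * z = - (of_real (1 - (norm z)\<^sup>2) * cnj z)"
proof (rule ccontr)
  assume neq: "\<mu> * z \<noteq> - (of_real (1 - (norm z)\<^sup>2) * cnj z)"
  define q where "q = 1 - (norm z)\<^sup>2"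
  have q: "q > 0" using z by (simp add: q_def abs_square_less_1)
  define c where "c = \<mu> * z / of_real q"
  have cq: "\<mu> * z = of_real q * c" using q by (simp add: c_def)
  have "c \<noteq> - cnj z" using neq unfolding cq q_def by auto
  \<comment> \<open>where the disc of values \<open>\<mu>/u\<close> meets the exterior\<close>
  define V where "V = ball c 1 - cball (- cnj z) 1"
  have "V \<noteq> {}"
    using \<open>c \<noteq> - cnj z\<close> ball_subset_cball_iff[of c 1 "- cnj z" 1] by (auto simp: V_def)
  moreover have "open V" unfolding V_def by (intro open_Diff) auto
  ultimately have "infinite V" by (metis finite_imp_not_open)
  \<comment> \<open>the fixed points of \<open>v \<mapsto> \<mu>/v\<close> must be avoided, and \<open>V\<close> is open\<close>
  moreover have "finite {v. v\<^sup>2 = \<mu>}"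
    using finite_nth_roots[of 2 \<mu>] by simp
  ultimately have "\<not> V \<subseteq> {v. v\<^sup>2 = \<mu>}" using finite_subset by auto
  then obtain v where v: "v \<in> V" "v\<^sup>2 \<noteq> \<mu>" by auto
  have v1: "norm (v - c) < 1" and v2: "norm (v + cnj z) > 1"
    using v(1) by (auto simp: V_def dist_norm norm_minus_commute add.commute)
  have v0: "v \<noteq> 0" using v2 z by auto
  have \<mu>0: "\<mu> \<noteq> 0" using \<mu> q by (auto simp: q_def)
  define u where "u = \<mu> / v"
  have u0: "u \<noteq> 0" using v0 \<mu>0 by (simp add: u_def)
  have uv: "u \<noteq> v" using v(2) v0 by (auto simp: u_def field_simps power2_eq_square)
  have u2: "norm (u + cnj z) > 1"
  proof -
    have "(norm v)\<^sup>2 - 2 * Re (cnj v * c) + (norm c)\<^sup>2 < 1"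
    proof -
      have "(norm (v - c))\<^sup>2 = (norm v)\<^sup>2 - 2 * Re (cnj v * c) + (norm c)\<^sup>2"
        unfolding cmod_power2 by (simp add: power2_eq_square algebra_simps)
      moreover have "(norm (v - c))\<^sup>2 < 1" using v1 by (simp add: abs_square_less_1)
      ultimately show ?thesis by linarith
    qed
    moreover have "norm c = norm z"
      unfolding c_def norm_divide norm_mult norm_of_real using \<mu> q by (simp add: q_def)
    ultimately have "(norm v)\<^sup>2 < q + 2 * Re (cnj v * c)" by (simp add: q_def)
    then have "q * (norm v)\<^sup>2 < q * (q + 2 * Re (cnj v * c))" using q by simp
    moreover have "(norm (\<mu> + cnj z * v))\<^sup>2 = q\<^sup>2 + 2 * (q * Re (cnj v * c)) + (1 - q) * (norm v)\<^sup>2"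
    proof -
      have "(norm (\<mu> + cnj z * v))\<^sup>2 = (norm \<mu>)\<^sup>2 + 2 * Re (cnj v * (\<mu> * z)) + (norm z)\<^sup>2 * (norm v)\<^sup>2"
        unfolding cmod_power2 by (simp add: power2_eq_square algebra_simps)
      also have "cnj v * (\<mu> * z) = of_real q * (cnj v * c)" by (simp add: cq mult_ac)
      also have "Re (of_real q * (cnj v * c)) = q * Re (cnj v * c)" by simp
      finally show ?thesis using \<mu> by (simp add: q_def)
    qed
    ultimately have "(norm v)\<^sup>2 < (norm (\<mu> + cnj z * v))\<^sup>2"
      by (simp add: algebra_simps power2_eq_square)
    then have "norm v < norm (\<mu> + cnj z * v)" by (rule power2_less_imp_less) simp
    moreover have "u + cnj z = (\<mu> + cnj z * v) / v" using v0 by (simp add: u_def add_divide_distrib)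
    ultimately show ?thesis using v0 by (simp add: norm_divide)
  qed
  have val: "1 / w + (b0 + \<mu> * (w / (1 - cnj z * w))) = x + cnj z + b0 + \<mu> / x"
    and inb: "w \<in> ball 0 1 - {0}"
    if "w = 1 / (x + cnj z)" "norm (x + cnj z) > 1" "x \<noteq> 0" for w x
  proof -
    have "x + cnj z \<noteq> 0" using that(2) by auto
    then have "1 - cnj z * w = x / (x + cnj z)" unfolding that(1) by (simp add: field_simps)
    then have "w / (1 - cnj z * w) = 1 / x" using that \<open>x + cnj z \<noteq> 0\<close> by simp
    then show "1 / w + (b0 + \<mu> * (w / (1 - cnj z * w))) = x + cnj z + b0 + \<mu> / x"
      using that(1) by simp
    show "w \<in> ball 0 1 - {0}" using that(1,2) \<open>x + cnj z \<noteq> 0\<close> by (simp add: norm_divide)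
  qed
  have "\<mu> / u = v" using \<mu>0 v0 by (simp add: u_def)
  then have "1 / (v + cnj z) = 1 / (u + cnj z)"
    by (intro inj_onD[OF inj _ inb[OF refl v2 v0] inb[OF refl u2 u0]])
      (unfold val[OF refl v2 v0] val[OF refl u2 u0], simp add: u_def)
  then have "v + cnj z = u + cnj z" by (metis divide_divide_eq_right div_by_1 mult_1)
  then show False using uv by simp
qed

lemma centered_derivative_bound:
  assumes hol: "g holomorphic_on ball 0 1" and inj: "inj_on (\<lambda>w. 1 / w + g w) (ball 0 1 - {0})"
    and z: "z \<in> ball 0 1"
  shows "norm (deriv g z) \<le> 1 / (1 - (norm z)\<^sup>2)"
    and "z \<noteq> 0 \<Longrightarrow> norm (deriv g z) = 1 / (1 - (norm z)\<^sup>2) \<Longrightarrow>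
      \<exists>c. \<forall>w\<in>ball 0 1. g w = c - of_real (1 - (norm z)\<^sup>2) * (cnj z / z) * (w / (1 - cnj z * w))"
proof -
  let ?D = "ball 0 1 :: complex set"
  define b where "b = (\<lambda>n. (deriv ^^ n) g 0 / fact n)"
  have g: "(\<lambda>n. b n * w ^ n) sums g w" if "w \<in> ?D" for w
    using holomorphic_power_series[OF hol that] by (simp add: b_def)
  then have sm: "summable (\<lambda>n. b n * w ^ n)" and gw: "(\<Sum>n. b n * w ^ n) = g w" if "w \<in> ?D" for w
    using that by (auto simp: sums_iff)
  have "inj_on (\<lambda>w. 1 / w + (\<Sum>n. b n * w ^ n)) (?D - {0})"
    by (rule inj_on_cong[THEN iffD1, OF _ inj]) (use gw in auto)
  note area = area_theorem[OF sm this]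
  have bound: "(\<Sum>n<N. real (Suc n) * (norm (b (Suc n)))\<^sup>2) \<le> 1" for N
  proof -
    have "(\<Sum>n<N. real (Suc n) * (norm (b (Suc n)))\<^sup>2) = (\<Sum>n=1..N. n * (norm (b n))\<^sup>2)"
      by (rule sum.reindex_bij_witness[of _ "\<lambda>n. n - 1" Suc]) auto
    then show ?thesis using area[of N] by linarith
  qed
  have "((\<lambda>w. \<Sum>n. b n * w ^ n) has_field_derivative (\<Sum>n. diffs b n * z ^ n)) (at z)"
    by (rule powser_disc_deriv(1)[OF sm z])
  then have "(g has_field_derivative (\<Sum>n. diffs b n * z ^ n)) (at z)"
    by (rule has_field_derivative_transform_within_open[of _ _ _ ?D]) (use z gw in auto)
  then have "deriv g z = (\<Sum>n. diffs b n * z ^ n)" by (rule DERIV_imp_deriv)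
  then have d: "(\<lambda>n. of_nat (Suc n) * b (Suc n) * z ^ n) sums deriv g z"
    using powser_disc_deriv(2)[OF sm z] by (simp add: diffs_def sums_iff)
  have nz: "norm z < 1" using z by simp
  note defect = weighted_cauchy_schwarz_defect[OF nz bound d]
  show "norm (deriv g z) \<le> 1 / (1 - (norm z)\<^sup>2)" by (rule defect(1))
  assume "z \<noteq> 0" and eq: "norm (deriv g z) = 1 / (1 - (norm z)\<^sup>2)"
  define q where "q = 1 - (norm z)\<^sup>2"
  define \<mu> where "\<mu> = deriv g z * of_real (q\<^sup>2)"
  have q: "q > 0" using nz by (simp add: q_def abs_square_less_1)
  have n\<mu>: "norm \<mu> = 1 - (norm z)\<^sup>2"
    unfolding \<mu>_def norm_mult eq q_def[symmetric] norm_of_real using q by (simp add: power2_eq_square)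
  have bS: "b (Suc n) = \<mu> * cnj z ^ n" for n
    using defect(2)[OF eq] by (simp add: \<mu>_def q_def)
  have gform: "g w = b 0 + \<mu> * (w / (1 - cnj z * w))" if w: "w \<in> ?D" for w
  proof -
    have "norm (cnj z * w) < 1" using norm_mult_less[of "cnj z" 1 w 1] w nz by simp
    then have "(\<lambda>n. (cnj z * w) ^ n) sums (1 / (1 - cnj z * w))" by (rule geometric_sums)
    from sums_mult[OF this, of "\<mu> * w"]
    have "(\<lambda>n. b (Suc n) * w ^ Suc n) sums (\<mu> * (w / (1 - cnj z * w)))"
      by (simp add: bS power_mult_distrib mult_ac)
    then have "(\<lambda>n. b n * w ^ n) sums (\<mu> * (w / (1 - cnj z * w)) + b 0 * w ^ 0)"
      by (rule sums_Suc)
    then show ?thesis using sums_unique2[OF g[OF w]] by (simp add: add.commute)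
  qed
  have "inj_on (\<lambda>w. 1 / w + (b 0 + \<mu> * (w / (1 - cnj z * w)))) (?D - {0})"
    by (rule inj_on_cong[THEN iffD1, OF _ inj]) (use gform in auto)
  from extremal_phase_of_injective[OF nz n\<mu> this]
  have "\<mu> = - (of_real (1 - (norm z)\<^sup>2) * (cnj z / z))"
    using \<open>z \<noteq> 0\<close> by (simp add: field_simps)
  then have "\<forall>w\<in>?D. g w = b 0 - of_real (1 - (norm z)\<^sup>2) * (cnj z / z) * (w / (1 - cnj z * w))"
    using gform by simp
  then show "\<exists>c. \<forall>w\<in>?D. g w = c - of_real (1 - (norm z)\<^sup>2) * (cnj z / z) * (w / (1 - cnj z * w))" ..
qed

section \<open>Moving the pole\<close>

text \<open>
The pole is moved to 0 by \<open>T w = (w + p)/(1 + p w)\<close> with inverse \<open>S\<close>. The constant \<open>P\<close> in \<open>G\<close>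
comes from \<open>(1 - p\<^sup>2)/(T w - p) = 1/w + p\<close>. At \<open>\<zeta> = S z\<close> both \<open>|G'|\<close> and the bound
\<open>1/(1 - |\<zeta>|\<^sup>2)\<close> acquire the same factor \<open>|1 - p z|\<^sup>2\<close>, so the inequality and its equality case
carry over.
\<close>

lemma derivative_bound:
  fixes p :: real
  assumes p: "\<bar>p\<bar> < 1" and hol: "g holomorphic_on ball 0 1"
    and inj: "inj_on (\<lambda>w. 1 / (w - of_real p) + g w) (ball 0 1 - {of_real p})"
    and z: "z \<in> ball 0 1"
  shows "norm (deriv g z) \<le> 1 / ((1 - p\<^sup>2) * (1 - (norm z)\<^sup>2))"
    and "z \<noteq> of_real p \<Longrightarrow> norm (deriv g z) = 1 / ((1 - p\<^sup>2) * (1 - (norm z)\<^sup>2)) \<Longrightarrow>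
      \<exists>c. \<forall>w\<in>ball 0 1. g w = c - of_real (1 - (norm z)\<^sup>2) / (1 - (of_real p)\<^sup>2)
             * ((cnj z - of_real p) / (z - of_real p)) * (w / (1 - cnj z * w))"
proof -
  define P where "P = (of_real p :: complex)"
  let ?D = "ball 0 1 :: complex set"
  define T where "T = (\<lambda>w. (w + P) / (1 + P * w))"
  define S where "S = (\<lambda>w. (w - P) / (1 - P * w))"
  define G where "G = (\<lambda>w. P + (1 - P\<^sup>2) * g (T w))"
  define \<zeta> where "\<zeta> = S z"
  have nP: "norm P < 1" using p by (simp add: P_def)
  have cP: "cnj P = P" by (simp add: P_def)
  have TM: "T = Moebius_function 0 (- P)" and SM: "S = Moebius_function 0 P"
    by (simp_all add: fun_eq_iff T_def S_def Moebius_function_simple cP)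
  have Tin: "T w \<in> ?D" and Sin: "S w \<in> ?D" and TS: "T (S w) = w" and ST: "S (T w) = w"
    if "w \<in> ?D" for w
    using that nP Moebius_function_norm_lt_1[of "- P" w 0] Moebius_function_norm_lt_1[of P w 0]
      Moebius_function_compose[of "- P" P w] Moebius_function_compose[of P "- P" w]
    by (auto simp: TM SM)
  have holT: "T holomorphic_on ?D" unfolding TM by (rule Moebius_function_holomorphic) (use nP in simp)
  have ne: "1 + P * w \<noteq> 0" "1 - P * w \<noteq> 0" if "w \<in> ?D" for w
  proof -
    have "norm (P * w) < 1" using norm_mult_less[OF nP, of w 1] that by simp
    then have "P * w \<noteq> - 1" "P * w \<noteq> 1" by (metis norm_minus_cancel norm_one less_irrefl)+
    then show "1 + P * w \<noteq> 0" "1 - P * w \<noteq> 0" by (auto simp: add_eq_0_iff)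
  qed
  have p2: "p\<^sup>2 < 1" using p by (simp add: abs_square_less_1)
  have P2: "1 - P\<^sup>2 = of_real (1 - p\<^sup>2)" by (simp add: P_def)
  then have P20: "1 - P\<^sup>2 \<noteq> 0" using p2 by (simp only: of_real_eq_0_iff)
  have G: "1 / w + G w = (1 - P\<^sup>2) * (1 / (T w - P) + g (T w))" "T w \<noteq> P" if w: "w \<in> ?D - {0}" for w
  proof -
    have eq: "T w - P = w * (1 - P\<^sup>2) / (1 + P * w)"
      using ne(1)[of w] w by (simp add: T_def field_simps power2_eq_square)
    then have "T w - P \<noteq> 0" using w P20 ne(1)[of w] by simp
    then show "T w \<noteq> P" by simp
    have "(1 - P\<^sup>2) * (1 / (T w - P)) = (1 + P * w) / w"
      unfolding eq using P20 by simp
    also have "\<dots> = 1 / w + P" using w by (simp add: add_divide_distrib)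
    finally show "1 / w + G w = (1 - P\<^sup>2) * (1 / (T w - P) + g (T w))"
      by (simp add: G_def distrib_left)
  qed
  have holG: "G holomorphic_on ?D"
    unfolding G_def
    by (intro holomorphic_intros holomorphic_on_compose_gen[OF holT hol, unfolded o_def]) (use Tin in auto)
  have injG: "inj_on (\<lambda>w. 1 / w + G w) (?D - {0})"
  proof (rule inj_onI)
    fix x y assume xy: "x \<in> ?D - {0}" "y \<in> ?D - {0}" "1 / x + G x = 1 / y + G y"
    then have "1 / (T x - P) + g (T x) = 1 / (T y - P) + g (T y)" using P20 by (simp add: G)
    then have "T x = T y"
      using inj_onD[OF inj[folded P_def], of "T x" "T y"] xy(1,2) Tin G(2) by auto
    then show "x = y" using ST xy(1,2) by (metis Diff_iff)
  qed
  have \<zeta>: "\<zeta> \<in> ?D" "T \<zeta> = z" using Sin TS z by (simp_all add: \<zeta>_def)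
  have one: "1 + P * \<zeta> = (1 - P\<^sup>2) / (1 - P * z)"
    using ne(2)[OF z] by (simp add: \<zeta>_def S_def field_simps power2_eq_square)
  have "(T has_field_derivative (1 - P\<^sup>2) / (1 + P * \<zeta>)\<^sup>2) (at \<zeta>)"
    unfolding T_def using ne(1)[OF \<zeta>(1)]
    by (auto intro!: derivative_eq_intros simp: power2_eq_square algebra_simps)
  also have "(1 - P\<^sup>2) / (1 + P * \<zeta>)\<^sup>2 = (1 - P * z)\<^sup>2 / (1 - P\<^sup>2)"
    unfolding one power_divide using P20 by (simp add: power2_eq_square[of "1 - P\<^sup>2"])
  finally have "((\<lambda>w. g (T w)) has_field_derivative deriv g z * ((1 - P * z)\<^sup>2 / (1 - P\<^sup>2))) (at \<zeta>)"
    using holomorphic_derivI[OF hol open_ball z] DERIV_chain2 \<zeta>(2) by metis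
  from DERIV_add[OF DERIV_const[of P] DERIV_cmult[OF this, of "1 - P\<^sup>2"]]
  have derG: "deriv G \<zeta> = deriv g z * (1 - P * z)\<^sup>2"
    using P20 by (intro DERIV_imp_deriv) (simp add: G_def)
  have norm1: "1 - (norm \<zeta>)\<^sup>2 = (1 - p\<^sup>2) * (1 - (norm z)\<^sup>2) / (norm (1 - P * z))\<^sup>2"
  proof -
    have "(norm (1 - P * z))\<^sup>2 - (norm (z - P))\<^sup>2 = (1 - p\<^sup>2) * (1 - (norm z)\<^sup>2)"
      unfolding cmod_power2 by (simp add: P_def power2_eq_square algebra_simps)
    then show ?thesis using ne(2)[OF z]
      by (simp add: \<zeta>_def S_def norm_divide power_divide field_simps)
  qed
  have npos: "(norm (1 - P * z))\<^sup>2 > 0" using ne(2)[OF z] by simp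
  have bound_eq: "1 / (1 - (norm \<zeta>)\<^sup>2) = (norm (1 - P * z))\<^sup>2 * (1 / ((1 - p\<^sup>2) * (1 - (norm z)\<^sup>2)))"
    unfolding norm1 by simp
  have normG: "norm (deriv G \<zeta>) = (norm (1 - P * z))\<^sup>2 * norm (deriv g z)"
    by (simp add: derG norm_mult norm_power)
  show "norm (deriv g z) \<le> 1 / ((1 - p\<^sup>2) * (1 - (norm z)\<^sup>2))"
    using centered_derivative_bound(1)[OF holG injG \<zeta>(1)] npos
    unfolding bound_eq normG by (simp only: mult_le_cancel_left_pos)
  assume zP: "z \<noteq> of_real p" and eq: "norm (deriv g z) = 1 / ((1 - p\<^sup>2) * (1 - (norm z)\<^sup>2))"
  have zP': "z - P \<noteq> 0" using zP by (simp add: P_def)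
  then have "\<zeta> \<noteq> 0" using ne(2)[OF z] by (simp add: \<zeta>_def S_def)
  moreover have "norm (deriv G \<zeta>) = 1 / (1 - (norm \<zeta>)\<^sup>2)" unfolding normG eq bound_eq ..
  ultimately obtain c where c: "\<And>w. w \<in> ?D \<Longrightarrow>
      G w = c - of_real (1 - (norm \<zeta>)\<^sup>2) * (cnj \<zeta> / \<zeta>) * (w / (1 - cnj \<zeta> * w))"
    using centered_derivative_bound(2)[OF holG injG \<zeta>(1)] by auto
  define q where "q = (of_real (1 - (norm z)\<^sup>2) :: complex)"
  define m where "m = 1 - P\<^sup>2"
  have m0: "m \<noteq> 0" using P20 by (simp add: m_def)
  have cne: "1 - P * cnj z \<noteq> 0" using ne(2)[of "cnj z"] z by simp
  have coef: "of_real (1 - (norm \<zeta>)\<^sup>2) * (cnj \<zeta> / \<zeta>) = m * q * (cnj z - P) / ((1 - P * cnj z)\<^sup>2 * (z - P))"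
  proof -
    have "of_real ((norm (1 - P * z))\<^sup>2) = (1 - P * z) * (1 - P * cnj z)"
      using complex_norm_square[of "1 - P * z"] by (simp add: cP)
    then have "of_real (1 - (norm \<zeta>)\<^sup>2) = m * q / ((1 - P * z) * (1 - P * cnj z))"
      unfolding norm1 m_def P2 q_def by (simp only: of_real_divide of_real_mult)
    moreover have "cnj \<zeta> / \<zeta> = ((cnj z - P) * (1 - P * z)) / ((1 - P * cnj z) * (z - P))"
      by (simp add: \<zeta>_def S_def cP)
    ultimately have "of_real (1 - (norm \<zeta>)\<^sup>2) * (cnj \<zeta> / \<zeta>) =
        m * q / ((1 - P * z) * (1 - P * cnj z)) * (((cnj z - P) * (1 - P * z)) / ((1 - P * cnj z) * (z - P)))"
      by (simp only:)
    then show ?thesis using ne(2)[OF z] by (simp add: power2_eq_square mult_ac)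
  qed
  \<comment> \<open>the extremal function for \<open>\<zeta>\<close>, pulled back by \<open>S\<close>, is affine in the extremal function for \<open>z\<close>\<close>
  have frac: "S w / (1 - cnj \<zeta> * S w) = (1 - P * cnj z)\<^sup>2 / m * (w / (1 - cnj z * w)) - P * (1 - P * cnj z) / m"
    if w: "w \<in> ?D" for w
  proof -
    have zw: "1 - cnj z * w \<noteq> 0"
    proof -
      have "norm (cnj z * w) < 1" using norm_mult_less[of "cnj z" 1 w 1] w z by simp
      then show ?thesis by force
    qed
    have 1: "1 - cnj \<zeta> * S w = m * (1 - cnj z * w) / ((1 - P * cnj z) * (1 - P * w))"
    proof -
      have "(1 - P * cnj z) * (1 - P * w) - (cnj z - P) * (w - P) = m * (1 - cnj z * w)"
        by (simp add: m_def algebra_simps power2_eq_square)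
      moreover have "cnj \<zeta> * S w = (cnj z - P) * (w - P) / ((1 - P * cnj z) * (1 - P * w))"
        by (simp add: \<zeta>_def S_def cP)
      moreover have "1 - x / y = (y - x) / y" if "y \<noteq> 0" for x y :: complex
        using that by (simp add: diff_divide_distrib)
      ultimately show ?thesis using ne(2)[OF w] cne by simp
    qed
    have "S w / (1 - cnj \<zeta> * S w) = (w - P) * (1 - P * cnj z) / (m * (1 - cnj z * w))"
      unfolding 1 unfolding S_def using ne(2)[OF w] cne by simp
    also have "\<dots> = (1 - P * cnj z)\<^sup>2 / m * (w / (1 - cnj z * w)) - P * (1 - P * cnj z) / m"
      using zw m0 by (simp add: field_simps power2_eq_square)
    finally show ?thesis .
  qed
  define k where "k = m * q * (cnj z - P) / ((1 - P * cnj z)\<^sup>2 * (z - P))"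
  have "g w = (c - P + k * (P * (1 - P * cnj z) / m)) / m - q / m * ((cnj z - P) / (z - P)) * (w / (1 - cnj z * w))"
    if w: "w \<in> ?D" for w
  proof -
    have "m * g w = G (S w) - P" using TS[OF w] by (simp add: G_def m_def)
    also have "\<dots> = c - P - k * (S w / (1 - cnj \<zeta> * S w))"
      using c[OF Sin[OF w]] unfolding coef k_def[symmetric] by simp
    also have "\<dots> = c - P + k * (P * (1 - P * cnj z) / m) - k * (1 - P * cnj z)\<^sup>2 / m * (w / (1 - cnj z * w))"
      unfolding frac[OF w] by (simp add: algebra_simps)
    also have "k * (1 - P * cnj z)\<^sup>2 / m = q * ((cnj z - P) / (z - P))"
      using cne m0 zP' by (simp add: k_def)
    finally have "m * g w = c - P + k * (P * (1 - P * cnj z) / m) - q * ((cnj z - P) / (z - P)) * (w / (1 - cnj z * w))" .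
    then have "g w = (c - P + k * (P * (1 - P * cnj z) / m) - q * ((cnj z - P) / (z - P)) * (w / (1 - cnj z * w))) / m"
      using m0 by (metis nonzero_mult_div_cancel_left)
    then show ?thesis by (simp add: diff_divide_distrib)
  qed
  then show "\<exists>c. \<forall>w\<in>ball 0 1. g w = c - of_real (1 - (norm z)\<^sup>2) / (1 - (of_real p)\<^sup>2)
             * ((cnj z - of_real p) / (z - of_real p)) * (w / (1 - cnj z * w))"
    unfolding q_def m_def P_def by blast
qed

section \<open>The class of univalent functions with a prescribed pole\<close>

text \<open>
A second pole would share the value \<open>\<infinity>\<close> with the first, which injectivity on the sphere forbids.
Hence \<open>f\<close> is holomorphic off \<open>p\<close>, and subtracting the principal part leaves a removable
singularity.
\<close>

lemma Sigma_class_regular_part: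
  assumes "f \<in> Sigma_class p" and p: "\<bar>p\<bar> < 1"
  obtains g where "g holomorphic_on ball 0 1"
    "\<And>z. z \<in> ball 0 1 - {of_real p} \<Longrightarrow> f z = 1 / (z - of_real p) + g z"
    "inj_on f (ball 0 1 - {of_real p})"
proof -
  let ?P = "of_real p :: complex" and ?D = "ball 0 1 :: complex set"
  have f: "f meromorphic_on ?D" "\<And>z. z \<in> ?D \<Longrightarrow> is_pole f z \<or> isCont f z"
    "inj_on (sphere_value f) ?D"
    and pole: "is_pole f ?P" "zorder f ?P = -1" "residue f ?P = 1"
    using assms(1) by (auto simp: Sigma_class_def univalent_meromorphic_on_def)
  have P: "?P \<in> ?D" using p by simp
  have nopole: "\<not> is_pole f z" if "z \<in> ?D - {?P}" for z
    using inj_onD[OF f(3), of z ?P] that P pole(1) by (auto simp: sphere_value_def)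
  have "f analytic_on {z}" if "z \<in> ?D - {?P}" for z
    using meromorphic_at_isCont_imp_analytic[of f z] meromorphic_on_subset[OF f(1), of "{z}"]
      nopole[OF that] f(2)[of z] that by auto
  then have hol: "f holomorphic_on ?D - {?P}"
    by (meson analytic_imp_holomorphic analytic_on_analytic_at)
  have inj: "inj_on f (?D - {?P})"
  proof (rule inj_onI)
    fix x y assume xy: "x \<in> ?D - {?P}" "y \<in> ?D - {?P}" "f x = f y"
    then have "sphere_value f x = sphere_value f y" by (simp add: sphere_value_def nopole)
    then show "x = y" using inj_onD[OF f(3)] xy by blast
  qed
  define q where "q = zor_poly f ?P"
  obtain r where r: "r > 0" "cball ?P r \<subseteq> ?D" "q holomorphic_on cball ?P r"
    "\<And>w. w \<in> cball ?P r - {?P} \<Longrightarrow> f w = q w / (w - ?P)"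
    using zorder_exist_pole[OF hol open_ball P pole(1)] unfolding pole(2) q_def by auto
  have "isolated_singularity_at f ?P"
    using f(1) P meromorphic_on_isolated_singularity by (metis meromorphic_on_subset empty_subsetI insert_subset)
  then have q1: "q ?P = 1" using residue_simple_pole[of f ?P] pole by (simp add: q_def)
  have "(q has_field_derivative deriv q ?P) (at ?P)"
    by (rule holomorphic_derivI[of q "ball ?P r"]) (use r in \<open>auto intro: holomorphic_on_subset\<close>)
  then have lim: "(\<lambda>w. (q w - q ?P) / (w - ?P)) \<midarrow>?P\<rightarrow> deriv q ?P"
    by (simp add: has_field_derivative_iff)
  have "eventually (\<lambda>w. w \<in> ball ?P r - {?P}) (at ?P)"
    using eventually_at_in_open[of "ball ?P r" ?P] r(1) by simp
  then have "eventually (\<lambda>w. (q w - q ?P) / (w - ?P) = f w - 1 / (w - ?P)) (at ?P)"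
    by eventually_elim (use r(4) in \<open>auto simp: q1 diff_divide_distrib\<close>)
  from Lim_transform_eventually[OF lim this]
  have lim: "(\<lambda>w. f w - 1 / (w - ?P)) \<midarrow>?P\<rightarrow> deriv q ?P" .
  \<comment> \<open>the numerator \<open>q\<close> of \<open>f\<close> has \<open>q(p) = 1\<close>, so the regular part tends to \<open>q'(p)\<close> at the pole\<close>
  define g where "g = (\<lambda>w. if w = ?P then deriv q ?P else f w - 1 / (w - ?P))"
  have "g holomorphic_on ?D"
    unfolding g_def
    by (rule removable_singularity[OF _ open_ball lim]) (use hol in \<open>auto intro!: holomorphic_intros\<close>)
  then show ?thesis using inj by (intro that[of g]) (auto simp: g_def)
qed

lemma regular_deriv_eq_deriv:
  assumes g: "g holomorphic_on ball 0 1" and z: "z \<in> ball 0 1"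
    and fg: "\<And>z. z \<in> ball 0 1 - {of_real p} \<Longrightarrow> f z = 1 / (z - of_real p) + g z"
  shows "regular_deriv p f z = deriv g z"
proof -
  let ?P = "of_real p :: complex" and ?D = "ball 0 1 :: complex set"
  have eq: "deriv g w = deriv f w + 1 / (w - ?P)\<^sup>2" if w: "w \<in> ?D - {?P}" for w
  proof -
    have "((\<lambda>w. 1 / (w - ?P) + g w) has_field_derivative (- 1 / (w - ?P)\<^sup>2 + deriv g w)) (at w)"
      using w by (auto intro!: derivative_eq_intros holomorphic_derivI[OF g] simp: power2_eq_square)
    then have "(f has_field_derivative (- 1 / (w - ?P)\<^sup>2 + deriv g w)) (at w)"
      by (rule has_field_derivative_transform_within_open[of _ _ _ "?D - {?P}"]) (use w fg in auto)
    then show ?thesis by (simp add: DERIV_imp_deriv)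
  qed
  have "deriv g \<midarrow>z\<rightarrow> deriv g z"
    using holomorphic_on_imp_continuous_on[OF holomorphic_deriv[OF g open_ball]] z
    by (simp add: continuous_on_eq_continuous_at isCont_def)
  moreover have "eventually (\<lambda>w. deriv g w = deriv f w + 1 / (w - ?P)\<^sup>2) (at z)"
  proof -
    have "eventually (\<lambda>w. w \<in> ?D - {z}) (at z)"
      using eventually_at_in_open[of ?D z] z by simp
    moreover have "eventually (\<lambda>w. w \<noteq> ?P) (at z)" by (rule eventually_neq_at_within)
    ultimately show ?thesis by eventually_elim (use eq in auto)
  qed
  ultimately have "(\<lambda>w. deriv f w + 1 / (w - ?P)\<^sup>2) \<midarrow>z\<rightarrow> deriv g z"
    by (rule Lim_transform_eventually)
  then show ?thesis unfolding regular_deriv_def by (rule remove_sings_eqI)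
qed

text \<open>
The phase factor \<open>(cnj z - p)/(z - p)\<close> has modulus 1 because \<open>p\<close> is real, and
\<open>w/(1 - cnj z w)\<close> has derivative \<open>1/(1 - |z|\<^sup>2)\<^sup>2\<close> at \<open>z\<close>.
\<close>

lemma extremal_derivative_norm:
  fixes p :: real and z :: complex
  assumes p: "\<bar>p\<bar> < 1" and z: "z \<in> ball 0 1 - {of_real p}"
    and g: "\<And>w. w \<in> ball 0 1 - {of_real p} \<Longrightarrow>
      g w = c - of_real (1 - (norm z)\<^sup>2) / (1 - (of_real p)\<^sup>2)
             * ((cnj z - of_real p) / (z - of_real p)) * (w / (1 - cnj z * w))"
  shows "norm (deriv g z) = 1 / ((1 - p\<^sup>2) * (1 - (norm z)\<^sup>2))"
proof -
  define q where "q = 1 - (norm z)\<^sup>2"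
  define a where "a = of_real q / (1 - (of_real p)\<^sup>2) * ((cnj z - of_real p) / (z - of_real p))"
  have q: "q > 0" using z by (simp add: q_def abs_square_less_1)
  have zz: "1 - cnj z * z = of_real q"
    using complex_norm_square[of z] by (simp add: q_def mult.commute)
  then have ne: "1 - cnj z * z \<noteq> 0" using q by simp
  have "((\<lambda>w. c - a * (w / (1 - cnj z * w))) has_field_derivative - (a / (1 - cnj z * z)\<^sup>2)) (at z)"
    using ne by (auto intro!: derivative_eq_intros simp: power2_eq_square mult.commute)
      (simp add: algebra_simps)
  then have "(g has_field_derivative - (a / (1 - cnj z * z)\<^sup>2)) (at z)"
    by (rule has_field_derivative_transform_within_open[of _ _ _ "ball 0 1 - {of_real p}"])
      (use z g in \<open>auto simp: a_def q_def\<close>)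
  then have "norm (deriv g z) = norm a / q\<^sup>2"
    unfolding zz using q by (simp add: DERIV_imp_deriv norm_divide norm_power)
  moreover have "norm a = q / (1 - p\<^sup>2)"
  proof -
    have "norm (1 - (of_real p)\<^sup>2 :: complex) = 1 - p\<^sup>2"
    proof -
      have "p\<^sup>2 < 1" using p by (simp add: abs_square_less_1)
      moreover have "(1 - (of_real p)\<^sup>2 :: complex) = of_real (1 - p\<^sup>2)" by simp
      ultimately show ?thesis by (simp only: norm_of_real)
    qed
    moreover have "norm (cnj z - of_real p) = norm (z - of_real p)"
      by (metis complex_cnj_complex_of_real complex_cnj_diff complex_mod_cnj)
    moreover have "norm (z - of_real p) \<noteq> 0" using z by simp
    ultimately show ?thesis using q by (simp add: a_def norm_mult norm_divide)
  qed
  ultimately have "norm (deriv g z) = q / (1 - p\<^sup>2) / q\<^sup>2" by simp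
  then show ?thesis unfolding q_def[symmetric] using q by (simp add: power2_eq_square[of q])
qed

theorem theorem5:
  fixes p :: real and f :: "complex \<Rightarrow> complex"
  assumes "0 \<le> p" and "p < 1"
    and "f \<in> Sigma_class p"
  shows "(\<exists>b :: nat \<Rightarrow> complex.
            (\<forall>z\<in>ball 0 1. summable (\<lambda>n. b n * z ^ n)) \<and>
            (\<forall>z\<in>ball 0 1 - {of_real p}. f z = 1 / (z - of_real p) + (\<Sum>n. b n * z ^ n)) \<and>
            (\<forall>z\<in>ball 0 1. regular_deriv p f z = deriv (\<lambda>w. \<Sum>n. b n * w ^ n) z))
       \<and> (\<forall>z\<in>ball 0 1. norm (regular_deriv p f z) \<le> 1 / ((1 - p\<^sup>2) * (1 - (norm z)\<^sup>2)))
       \<and> (\<forall>z0\<in>ball 0 1 - {0, of_real p}.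
            norm (regular_deriv p f z0) = 1 / ((1 - p\<^sup>2) * (1 - (norm z0)\<^sup>2)) \<longleftrightarrow>
            (\<exists>b0. \<forall>z\<in>ball 0 1 - {of_real p}.
               f z = 1 / (z - of_real p) + b0
                     - ((inverse z0 - cnj z0) / (1 - (of_real p)\<^sup>2))
                       * ((cnj z0 - of_real p) / (z0 - of_real p))
                       * (z0 * z / (1 - cnj z0 * z))))"
proof -
  let ?P = "of_real p :: complex" and ?D = "ball 0 1 :: complex set"
  have p: "\<bar>p\<bar> < 1" using assms by simp
  obtain g where hol: "g holomorphic_on ?D"
    and fg: "\<And>z. z \<in> ?D - {?P} \<Longrightarrow> f z = 1 / (z - ?P) + g z" and injf: "inj_on f (?D - {?P})"
    using Sigma_class_regular_part[OF assms(3) p] by blast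
  have inj: "inj_on (\<lambda>w. 1 / (w - ?P) + g w) (?D - {?P})"
    by (rule inj_on_cong[THEN iffD1, OF _ injf]) (use fg in auto)
  have rd: "regular_deriv p f z = deriv g z" if "z \<in> ?D" for z
    by (rule regular_deriv_eq_deriv[OF hol that fg])
  define b where "b = (\<lambda>n. (deriv ^^ n) g 0 / fact n)"
  have b: "(\<lambda>n. b n * z ^ n) sums g z" if "z \<in> ?D" for z
    using holomorphic_power_series[OF hol that] by (simp add: b_def)
  have db: "deriv (\<lambda>w. \<Sum>n. b n * w ^ n) z = deriv g z" if "z \<in> ?D" for z
  proof (rule deriv_cong_ev)
    show "\<forall>\<^sub>F w in nhds z. (\<Sum>n. b n * w ^ n) = g w"
      using eventually_nhds_in_open[OF open_ball that]
      by eventually_elim (use b sums_unique in metis)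
  qed simp
  have series: "\<exists>b :: nat \<Rightarrow> complex.
            (\<forall>z\<in>?D. summable (\<lambda>n. b n * z ^ n)) \<and>
            (\<forall>z\<in>?D - {?P}. f z = 1 / (z - ?P) + (\<Sum>n. b n * z ^ n)) \<and>
            (\<forall>z\<in>?D. regular_deriv p f z = deriv (\<lambda>w. \<Sum>n. b n * w ^ n) z)"
  proof (rule exI[of _ b], intro conjI ballI)
    fix z assume "z \<in> ?D"
    then show "summable (\<lambda>n. b n * z ^ n)" using b sums_summable by blast
  next
    fix z assume z: "z \<in> ?D - {?P}"
    then have "(\<Sum>n. b n * z ^ n) = g z" using b sums_unique by (metis DiffD1)
    then show "f z = 1 / (z - ?P) + (\<Sum>n. b n * z ^ n)" using fg[OF z] by simp
  qed (simp only: rd db)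
  have bound: "norm (regular_deriv p f z) \<le> 1 / ((1 - p\<^sup>2) * (1 - (norm z)\<^sup>2))" if "z \<in> ?D" for z
    unfolding rd[OF that] by (rule derivative_bound(1)[OF p hol inj that])
  have equality: "norm (regular_deriv p f z0) = 1 / ((1 - p\<^sup>2) * (1 - (norm z0)\<^sup>2)) \<longleftrightarrow>
            (\<exists>b0. \<forall>z\<in>?D - {?P}. f z = 1 / (z - ?P) + b0
                     - ((inverse z0 - cnj z0) / (1 - ?P\<^sup>2))
                       * ((cnj z0 - ?P) / (z0 - ?P)) * (z0 * z / (1 - cnj z0 * z)))"
    (is "?E \<longleftrightarrow> ?F") if z0: "z0 \<in> ?D - {0, ?P}" for z0
  proof -
    have z0D: "z0 \<in> ?D" "z0 \<noteq> ?P" "z0 \<noteq> 0" using z0 by auto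
    have zz: "(inverse z0 - cnj z0) * z0 = of_real (1 - (norm z0)\<^sup>2)"
    proof -
      have "(inverse z0 - cnj z0) * z0 = 1 - z0 * cnj z0"
        using z0D(3) unfolding left_diff_distrib by (simp add: mult.commute)
      then show ?thesis using complex_norm_square[of z0] by simp
    qed
    \<comment> \<open>the factor \<open>z0\<close> of the last numerator, absorbed into the first coefficient, leaves \<open>1 - |z0|\<^sup>2\<close>\<close>
    have coef: "((inverse z0 - cnj z0) / (1 - ?P\<^sup>2)) * ((cnj z0 - ?P) / (z0 - ?P)) * (z0 * z / (1 - cnj z0 * z))
        = of_real (1 - (norm z0)\<^sup>2) / (1 - ?P\<^sup>2) * ((cnj z0 - ?P) / (z0 - ?P)) * (z / (1 - cnj z0 * z))" for z
      unfolding zz[symmetric] by simp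
    show ?thesis unfolding rd[OF z0D(1)] coef
    proof
      assume "norm (deriv g z0) = 1 / ((1 - p\<^sup>2) * (1 - (norm z0)\<^sup>2))"
      from derivative_bound(2)[OF p hol inj z0D(1,2) this] obtain c where
        c: "\<forall>w\<in>?D. g w = c - of_real (1 - (norm z0)\<^sup>2) / (1 - ?P\<^sup>2)
             * ((cnj z0 - ?P) / (z0 - ?P)) * (w / (1 - cnj z0 * w))" ..
      show "\<exists>b0. \<forall>z\<in>?D - {?P}. f z = 1 / (z - ?P) + b0 - of_real (1 - (norm z0)\<^sup>2) / (1 - ?P\<^sup>2)
             * ((cnj z0 - ?P) / (z0 - ?P)) * (z / (1 - cnj z0 * z))"
      proof (intro exI[of _ c] ballI)
        fix z assume z: "z \<in> ?D - {?P}"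
        then show "f z = 1 / (z - ?P) + c - of_real (1 - (norm z0)\<^sup>2) / (1 - ?P\<^sup>2)
             * ((cnj z0 - ?P) / (z0 - ?P)) * (z / (1 - cnj z0 * z))"
          using c[rule_format, of z] fg[OF z] by (simp only: DiffD1 add_diff_eq)
      qed
    next
      assume "\<exists>b0. \<forall>z\<in>?D - {?P}. f z = 1 / (z - ?P) + b0 - of_real (1 - (norm z0)\<^sup>2) / (1 - ?P\<^sup>2)
             * ((cnj z0 - ?P) / (z0 - ?P)) * (z / (1 - cnj z0 * z))"
      then obtain c where c: "\<forall>z\<in>?D - {?P}. f z = 1 / (z - ?P) + c - of_real (1 - (norm z0)\<^sup>2) / (1 - ?P\<^sup>2)
             * ((cnj z0 - ?P) / (z0 - ?P)) * (z / (1 - cnj z0 * z))" ..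
      show "norm (deriv g z0) = 1 / ((1 - p\<^sup>2) * (1 - (norm z0)\<^sup>2))"
      proof (rule extremal_derivative_norm[OF p])
        show "z0 \<in> ?D - {?P}" using z0 by auto
        fix w assume w: "w \<in> ?D - {?P}"
        have "1 / (w - ?P) + g w = 1 / (w - ?P) + (c - of_real (1 - (norm z0)\<^sup>2) / (1 - ?P\<^sup>2)
             * ((cnj z0 - ?P) / (z0 - ?P)) * (w / (1 - cnj z0 * w)))"
          using c w fg[OF w] by (simp only: add_diff_eq)
        then show "g w = c - of_real (1 - (norm z0)\<^sup>2) / (1 - ?P\<^sup>2)
             * ((cnj z0 - ?P) / (z0 - ?P)) * (w / (1 - cnj z0 * w))"
          by (rule add_left_imp_eq)
      qed
    qed
  qed
  show ?thesis using series bound equality by blast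
qed

end
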